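(* Let $d,m\ge1$ be integers, let $L<\infty$, let $\Omega:=\mathcal{G}_L$ be the space of quasiperiodic cocycles $(\alpha,A)\in\mathbb{T}^d\times C^0(\mathbb{T}^d,\mathrm{SL}_m(\mathbb{R}))$ with $\|A\|_0\le L$, let $X=\Omega^{\mathbb{Z}}$, and let $f\colon X\times\mathbb{T}^d\to X\times\mathbb{T}^d$, $f(\omega,\theta)=(\sigma\omega,\theta+\mathfrak{a}(\omega_0))$, where $\mathfrak{a}(\alpha,A)=\alpha$. Let $\lambda$ denote the Haar probability measure on $\mathbb{T}^d$. Call $\nu\in\mathrm{Prob}_c(\Omega)$ ergodic with respect to $f$ if $f$ is ergodic with respect to $\nu^{\mathbb{Z}}\times\lambda$. Let $\nu_0\in\mathrm{Prob}_c(\Omega)$ be an ergodic measure with respect to $f$. Given any $\epsilon>0$, there are $\delta=\delta(\epsilon,\nu_0,L)>0$, $\bar n=\bar n(\epsilon,\nu_0,L)\in\mathbb{N}$ and $c=c(\epsilon,\nu_0,L)>0$ such that for all $\nu\in\mathrm{Prob}_c(\Omega)$ with $W_1(\nu,\nu_0)<\delta$, for all $\theta\in\mathbb{T}^d$ and for all $n\ge\bar n$ we have $$\nu^{\mathbb{Z}}\left\{\omega\in X\colon\frac1n\log\|\mathcal{A}^n(\omega)(\theta)\|\ge L_1(\nu_0)+\epsilon\right\}<e^{-cn}.$$ Moreover, the map $\nu\mapsto L_1(\nu)$ is upper semicontinuous with respect to the Wasserstein metric $W_1$ in the space of measures in $\mathrm{Prob}_c(\Omega)$ that are ergodic with respect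 to $f$.
   Context: $\mathbb{T}^d=(\mathbb{R}/\mathbb{Z})^d$. Let $\mathcal{G}=\mathbb{T}^d\times C^0(\mathbb{T}^d,\mathrm{SL}_m(\mathbb{R}))$, equipped with the product metric: the sum of the standard distance on $\mathbb{T}^d$ and the uniform distance $\|A-B\|_0=\sup_{\theta\in\mathbb{T}^d}\|A(\theta)-B(\theta)\|$ on $C^0(\mathbb{T}^d,\mathrm{SL}_m(\mathbb{R}))$, where $\|\cdot\|$ is the operator norm of matrices; this makes $\mathcal{G}$ a Polish metric space. Put $\mathcal{G}_L:=\{(\alpha,A)\in\mathcal{G}\colon\|A\|_0\le L\}$, where $\|A\|_0=\sup_\theta\|A(\theta)\|$; it is a closed subset of $\mathcal{G}$ with the induced metric. $\sigma$ is the left shift on $X=\Omega^{\mathbb{Z}}$ (product topology), $(\sigma\omega)_n=\omega_{n+1}$. $\mathrm{Prob}_c(\Omega)$ is the set of compactly supported Borel probability measures on $\Omega$ and $\nu^{\mathbb{Z}}$ is the product measure on $X$; $f$ preserves $\nu^{\mathbb{Z}}\times\lambda$. Cocycle iterates: let $\mathcal{A}\colon\Omega\to C^0(\mathbb{T}^d,\mathrm{SL}_m(\mathbb{R}))$, $\mathcal{A}(\alpha,A)=A$. For $\omega=\{\omega_n\}_{n\in\mathbb{Z}}\in X$, $\theta\in\mathbb{T}^d$ and $n\ge1$, $$\mathcal{A}^n(\omega)(\theta)=\mathcal{A}(\omega_{n-1})(\theta_{n-1})\cdots\mathcal{A}(\omega_1)(\theta_1)\,\mathcal{A}(\omega_0)(\theta_0),\qquad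 \theta_0=\theta,\quad \theta_j=\theta+\mathfrak{a}(\omega_0)+\dots+\mathfrak{a}(\omega_{j-1}).$$ Maximal Lyapunov exponent: if $\nu$ is ergodic with respect to $f$, then $L_1(\nu)$ is the constant such that $\lim_{n\to\infty}\frac1n\log\|\mathcal{A}^n(\omega)(\theta)\|=L_1(\nu)$ for $\nu^{\mathbb{Z}}\times\lambda$-a.e. $(\omega,\theta)$; it exists by the subadditive ergodic theorem and equals $\lim_{n\to\infty}\int_{X\times\mathbb{T}^d}\frac1n\log\|\mathcal{A}^n(\omega)(\theta)\|\,d(\nu^{\mathbb{Z}}\times\lambda)$. Wasserstein distance: for $\nu,\nu'\in\mathrm{Prob}_c(\Omega)$, $W_1(\nu,\nu'):=\sup\{\int g\,d(\nu-\nu')\colon g\colon\Omega\to\mathbb{R}\text{ Lipschitz with Lipschitz constant at most }1\}$. *)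

theory Defs
  imports "HOL-Probability.Probability"
begin

section \<open>The torus\<close>

text \<open>\<open>circle\<close> is \<open>\<real>/\<int>\<close>, and \<open>\<real>/\<int>\<close> carries the quotient metric: the distance of a difference
  to the nearest integer.  The library metric on vectors then gives the flat quotient metric
  on \<open>(\<real>/\<int>)\<^sup>d\<close>.\<close>

quotient_type circle = real / "\<lambda>x y :: real. x - y \<in> \<int>"
  morphisms rep_circle to_circle
proof (rule equivpI)
  show "reflp (\<lambda>x y :: real. x - y \<in> \<int>)"
    by (simp add: reflp_def)
  show "symp (\<lambda>x y :: real. x - y \<in> \<int>)"
    by (metis (no_types, lifting) Ints_minus minus_diff_eq sympI)
  show "transp (\<lambda>x y :: real. x - y \<in> \<int>)"
  proof (rule transpI)
    fix x y z :: real
    assume "x - y \<in> \<int>" "y - z \<in> \<int>"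
    then have "(x - y) + (y - z) \<in> \<int>" by (rule Ints_add)
    then show "x - z \<in> \<int>" by simp
  qed
qed

instantiation circle :: ab_group_add
begin

lift_definition zero_circle :: circle is "0 :: real" .

lift_definition plus_circle :: "circle \<Rightarrow> circle \<Rightarrow> circle" is "(+) :: real \<Rightarrow> real \<Rightarrow> real"
  using Ints_add by (metis add_diff_add)

lift_definition uminus_circle :: "circle \<Rightarrow> circle" is "uminus :: real \<Rightarrow> real"
  by (metis Ints_minus minus_diff_minus)

lift_definition minus_circle :: "circle \<Rightarrow> circle \<Rightarrow> circle" is "(-) :: real \<Rightarrow> real \<Rightarrow> real"
proof -
  fix a b c d :: real
  assume "a - b \<in> \<int>" "c - d \<in> \<int>"
  then have "(a - b) - (c - d) \<in> \<int>" by (rule Ints_diff)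
  then show "(a - c) - (b - d) \<in> \<int>" by (simp add: algebra_simps)
qed

instance
  by standard (transfer; simp)+

end

lemma infdist_Ints_shift:
  fixes x y :: real
  assumes "x - y \<in> \<int>"
  shows "infdist x \<int> = infdist y \<int>"
proof -
  have "infdist u \<int> \<le> infdist v \<int>" if "u - v \<in> \<int>" for u v :: real
  proof -
    have "infdist u \<int> \<le> dist v k" if "k \<in> \<int>" for k
    proof (rule infdist_le2)
      show "k + (u - v) \<in> \<int>"
        using \<open>u - v \<in> \<int>\<close> \<open>k \<in> \<int>\<close> by (rule Ints_add[rotated])
      show "dist u (k + (u - v)) \<le> dist v k"
        by (simp add: dist_real_def)
    qed
    moreover have "(\<int> :: real set) \<noteq> {}" using Ints_0 by blast
    ultimately show ?thesis
      by (simp add: infdist_notempty[of \<int> v] cINF_greatest)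
  qed
  from this[OF assms] this[of y x] assms show ?thesis
    by (metis Ints_minus minus_diff_eq order_antisym)
qed

lemma infdist_Ints_add:
  fixes x y :: real
  shows "infdist (x + y) \<int> \<le> infdist x \<int> + infdist y \<int>"
proof -
  have ne: "(\<int> :: real set) \<noteq> {}" using Ints_0 by blast
  have "infdist (x + y) \<int> - infdist y \<int> \<le> dist x k" if "k \<in> \<int>" for k
  proof -
    have "infdist (x + y) \<int> = infdist (x + y - k) \<int>"
      by (rule infdist_Ints_shift) (use that in simp)
    also have "\<dots> \<le> infdist y \<int> + dist (x + y - k) y"
      by (rule infdist_triangle)
    finally show ?thesis by (simp add: dist_real_def)
  qed
  then have "infdist (x + y) \<int> - infdist y \<int> \<le> infdist x \<int>"
    by (simp add: infdist_notempty[OF ne, of x] cINF_greatest ne)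
  then show ?thesis by simp
qed

lemma infdist_Ints_minus:
  fixes x :: real
  shows "infdist (- x) \<int> = infdist x \<int>"
proof -
  have "infdist (- x) \<int> \<le> infdist x \<int>" for x :: real
  proof -
    have ne: "(\<int> :: real set) \<noteq> {}" using Ints_0 by blast
    have "infdist (- x) \<int> \<le> dist x k" if "k \<in> \<int>" for k
      by (rule infdist_le2[of "- k"]) (use that in \<open>auto simp: dist_real_def\<close>)
    then show ?thesis
      by (simp add: infdist_notempty[OF ne, of x] cINF_greatest ne)
  qed
  from this[of x] this[of "- x"] show ?thesis by simp
qed

instantiation circle :: metric_space
begin

lift_definition dist_circle :: "circle \<Rightarrow> circle \<Rightarrow> real" is "\<lambda>x y. infdist (x - y) \<int>"
proof -
  fix a b c d :: real
  assume "a - b \<in> \<int>" "c - d \<in> \<int>"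
  then have "(a - b) - (c - d) \<in> \<int>" by (rule Ints_diff)
  then show "infdist (a - c) \<int> = infdist (b - d) \<int>"
    by (intro infdist_Ints_shift) (simp add: algebra_simps)
qed

definition uniformity_circle :: "(circle \<times> circle) filter"
  where "uniformity_circle = (INF e\<in>{0 <..}. principal {(x, y). dist x y < e})"

definition open_circle :: "circle set \<Rightarrow> bool"
  where "open_circle S = (\<forall>x\<in>S. \<forall>\<^sub>F (x', y) in uniformity. x' = x \<longrightarrow> y \<in> S)"

instance
proof
  fix x y z :: circle and S :: "circle set"
  show "uniformity = (INF e\<in>{0 <..}. principal {(x, y :: circle). dist x y < e})"
    by (rule uniformity_circle_def)
  show "open S = (\<forall>x\<in>S. \<forall>\<^sub>F (x', y) in uniformity. x' = x \<longrightarrow> y \<in> S)"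
    by (rule open_circle_def)
  show "dist x y = 0 \<longleftrightarrow> x = y"
  proof transfer
    fix a b :: real
    show "infdist (a - b) \<int> = 0 \<longleftrightarrow> a - b \<in> \<int>"
      using in_closed_iff_infdist_zero[of "\<int> :: real set" "a - b"] closed_Ints Ints_0 by blast
  qed
  show "dist x y \<le> dist x z + dist y z"
  proof transfer
    fix a b c :: real
    have "infdist (a - b) \<int> \<le> infdist (a - c) \<int> + infdist (c - b) \<int>"
      using infdist_Ints_add[of "a - c" "c - b"] by simp
    then show "infdist (a - b) \<int> \<le> infdist (a - c) \<int> + infdist (b - c) \<int>"
      using infdist_Ints_minus[of "b - c"] by simp
  qed
qed

end

type_synonym 'd torus = "circle ^ 'd"

definition torus_proj :: "real ^ 'd \<Rightarrow> 'd torus" where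
  "torus_proj x = (\<chi> i. to_circle (x $ i))"

text \<open>The Haar probability measure, as the image of Lebesgue measure on the fundamental domain
  \<open>[0, 1)\<^sup>d\<close>.\<close>

definition torus_haar :: "('d::finite) torus measure" where
  "torus_haar = distr (restrict_space lborel {x :: real ^ 'd. \<forall>i. 0 \<le> x $ i \<and> x $ i < 1})
     borel torus_proj"

lemma dist_to_circle_le: "dist (to_circle x) (to_circle y) \<le> dist x y"
  by (simp add: dist_circle.abs_eq infdist_le2[of 0] dist_real_def)

lemma continuous_on_torus_proj: "continuous_on S (torus_proj :: real ^ ('d::finite) \<Rightarrow> _)"
proof -
  have "1-lipschitz_on UNIV to_circle"
    by (rule lipschitz_onI) (simp_all add: dist_to_circle_le)
  then have "continuous_on UNIV to_circle"
    by (rule lipschitz_on_continuous_on)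
  then have *: "continuous_on A to_circle" for A
    by (rule continuous_on_subset) simp
  show ?thesis
    unfolding torus_proj_def
    by (intro continuous_intros continuous_on_compose2[OF *]) auto
qed

lemma prob_space_torus_haar: "prob_space (torus_haar :: ('d::finite) torus measure)"
proof -
  let ?Q = "{x :: real ^ 'd. \<forall>i. 0 \<le> x $ i \<and> x $ i < 1}"
  have Q: "?Q \<in> sets lborel" by measurable
  have sub: "box 0 1 \<subseteq> ?Q" "?Q \<subseteq> cbox 0 1"
    by (auto simp: mem_box_cart less_imp_le)
  have one: "(1 :: real ^ 'd) \<bullet> b = 1" if "b \<in> Basis" for b
    using that by (auto simp: Basis_vec_def inner_axis)
  have "emeasure lborel (box 0 1 :: (real ^ 'd) set) = 1" "emeasure lborel (cbox 0 1 :: (real ^ 'd) set) = 1"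
    using one by (simp_all add: emeasure_lborel_box_eq emeasure_lborel_cbox_eq)
  then have "emeasure lborel ?Q = 1"
    using emeasure_mono[OF sub(1) Q] emeasure_mono[OF sub(2), of lborel] by auto
  then have "prob_space (restrict_space lborel ?Q)"
    using Q by (intro prob_spaceI) (simp add: emeasure_restrict_space space_restrict_space)
  moreover have "torus_proj \<in> restrict_space lborel ?Q \<rightarrow>\<^sub>M borel"
    by (intro measurable_restrict_space1) (simp add: borel_measurable_continuous_onI continuous_on_torus_proj)
  ultimately show ?thesis
    unfolding torus_haar_def by (rule prob_space.prob_space_distr)
qed

section \<open>Quasiperiodic cocycles\<close>

text \<open>An \<open>m \<times> m\<close> matrix is represented by the linear operator it induces on Euclidean
  \<open>\<real>\<^sup>m\<close>, so that the library norm is the operator norm.  As the torus is compact, every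
  continuous function on it is bounded, and the library metric and norm on bounded continuous
  functions are the uniform distance and \<open>\<parallel>A\<parallel>\<^sub>0\<close>.
  A new type is used because the library metric on pairs is the Euclidean
  combination of the two distances and not their sum.\<close>

typedef (overloaded) ('d, 'm) cocycle =
  "{p :: ('d::finite) torus \<times> ('d torus \<Rightarrow>\<^sub>C ((real ^ ('m::finite)) \<Rightarrow>\<^sub>L (real ^ 'm))).
     \<forall>\<theta>. det (matrix (blinfun_apply (apply_bcontfun (snd p) \<theta>))) = 1}"
  morphisms cocycle_pair Cocycle
proof -
  have "(0, const_bcontfun id_blinfun) \<in>
    {p :: ('d::finite) torus \<times> ('d torus \<Rightarrow>\<^sub>C ((real ^ ('m::finite)) \<Rightarrow>\<^sub>L (real ^ 'm))).
     \<forall>\<theta>. det (matrix (blinfun_apply (apply_bcontfun (snd p) \<theta>))) = 1}"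
    by (simp add: const_bcontfun.rep_eq id_blinfun.rep_eq matrix_id_mat_1[unfolded id_def])
  then show ?thesis by blast
qed

definition freq :: "('d::finite, 'm::finite) cocycle \<Rightarrow> 'd torus" where
  "freq x = fst (cocycle_pair x)"

definition fibre :: "('d::finite, 'm::finite) cocycle \<Rightarrow>
    'd torus \<Rightarrow>\<^sub>C ((real ^ 'm) \<Rightarrow>\<^sub>L (real ^ 'm))" where
  "fibre x = snd (cocycle_pair x)"

instantiation cocycle :: (finite, finite) metric_space
begin

definition dist_cocycle :: "('a, 'b) cocycle \<Rightarrow> ('a, 'b) cocycle \<Rightarrow> real"
  where "dist_cocycle x y = dist (freq x) (freq y) + dist (fibre x) (fibre y)"

definition uniformity_cocycle :: "(('a, 'b) cocycle \<times> ('a, 'b) cocycle) filter"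
  where "uniformity_cocycle = (INF e\<in>{0 <..}. principal {(x, y). dist x y < e})"

definition open_cocycle :: "('a, 'b) cocycle set \<Rightarrow> bool"
  where "open_cocycle S = (\<forall>x\<in>S. \<forall>\<^sub>F (x', y) in uniformity. x' = x \<longrightarrow> y \<in> S)"

instance
proof
  fix x y z :: "('a, 'b) cocycle" and S :: "('a, 'b) cocycle set"
  show "uniformity = (INF e\<in>{0 <..}. principal {(x, y :: ('a, 'b) cocycle). dist x y < e})"
    by (rule uniformity_cocycle_def)
  show "open S = (\<forall>x\<in>S. \<forall>\<^sub>F (x', y) in uniformity. x' = x \<longrightarrow> y \<in> S)"
    by (rule open_cocycle_def)
  show "dist x y = 0 \<longleftrightarrow> x = y"
    by (simp add: dist_cocycle_def add_nonneg_eq_0_iff freq_def fibre_def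
        flip: prod_eq_iff cocycle_pair_inject)
  show "dist x y \<le> dist x z + dist y z"
    using dist_triangle2[of "freq x" "freq y" "freq z"] dist_triangle2[of "fibre x" "fibre y" "fibre z"]
    by (simp add: dist_cocycle_def)
qed

end

definition cocycles_le :: "real \<Rightarrow> ('d::finite, 'm::finite) cocycle set" where
  "cocycles_le L = {x. norm (fibre x) \<le> L}"

section \<open>Measures and the Wasserstein distance\<close>

definition Prob_c :: "'a::metric_space set \<Rightarrow> 'a measure set" where
  "Prob_c \<Omega> = {\<nu>. prob_space \<nu> \<and> sets \<nu> = sets (restrict_space borel \<Omega>) \<and>
     (\<exists>K\<subseteq>\<Omega>. compact K \<and> measure \<nu> K = 1)}"

text \<open>The supremum below is over a nonempty set, and it is bounded above when \<open>\<Omega>\<close> is bounded, as for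
  \<open>cocycles_le L\<close>, so that the real-valued \<open>SUP\<close> is the actual supremum.  The values of \<open>g\<close> outside
  \<open>\<Omega>\<close> are irrelevant, since \<open>\<Omega>\<close> is the underlying space of both measures.\<close>

definition W1 :: "'a::metric_space set \<Rightarrow> 'a measure \<Rightarrow> 'a measure \<Rightarrow> real" where
  "W1 \<Omega> \<nu> \<nu>' = (SUP g \<in> {g :: 'a \<Rightarrow> real. 1-lipschitz_on \<Omega> g}.
     integral\<^sup>L \<nu> g - integral\<^sup>L \<nu>' g)"

definition upper_semicontinuous_wrt ::
  "('a \<Rightarrow> 'a \<Rightarrow> real) \<Rightarrow> 'a set \<Rightarrow> ('a \<Rightarrow> real) \<Rightarrow> bool" where
  "upper_semicontinuous_wrt \<rho> S F \<longleftrightarrow>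
     (\<forall>x\<in>S. \<forall>\<epsilon>>0. \<exists>\<delta>>0. \<forall>y\<in>S. \<rho> y x < \<delta> \<longrightarrow> F y < F x + \<epsilon>)"

section \<open>The skew product and its Lyapunov exponent\<close>

definition bernoulli_measure :: "'a measure \<Rightarrow> (int \<Rightarrow> 'a) measure" where
  "bernoulli_measure \<nu> = PiM UNIV (\<lambda>_. \<nu>)"

definition shift :: "(int \<Rightarrow> 'a) \<Rightarrow> int \<Rightarrow> 'a" where
  "shift \<omega> = (\<lambda>n. \<omega> (n + 1))"

definition skew ::
  "(int \<Rightarrow> ('d::finite, 'm::finite) cocycle) \<times> 'd torus \<Rightarrow>
   (int \<Rightarrow> ('d, 'm) cocycle) \<times> 'd torus" where
  "skew = (\<lambda>(\<omega>, \<theta>). (shift \<omega>, \<theta> + freq (\<omega> 0)))"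

definition ergodic_map :: "'a measure \<Rightarrow> ('a \<Rightarrow> 'a) \<Rightarrow> bool" where
  "ergodic_map M f \<longleftrightarrow> f \<in> measurable M M \<and> distr M M f = M \<and>
     (\<forall>A\<in>sets M. f -` A \<inter> space M = A \<longrightarrow> measure M A = 0 \<or> measure M A = 1)"

definition ergodic_measures :: "real \<Rightarrow> ('d::finite, 'm::finite) cocycle measure set" where
  "ergodic_measures L =
     {\<nu> \<in> Prob_c (cocycles_le L). ergodic_map (bernoulli_measure \<nu> \<Otimes>\<^sub>M torus_haar) skew}"

definition orbit ::
  "(int \<Rightarrow> ('d::finite, 'm::finite) cocycle) \<Rightarrow> 'd torus \<Rightarrow> nat \<Rightarrow> 'd torus" where
  "orbit \<omega> \<theta> j = \<theta> + (\<Sum>i<j. freq (\<omega> (int i)))"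

primrec iterate ::
  "nat \<Rightarrow> (int \<Rightarrow> ('d::finite, 'm::finite) cocycle) \<Rightarrow> 'd torus \<Rightarrow> ((real ^ 'm) \<Rightarrow>\<^sub>L (real ^ 'm))" where
  "iterate 0 \<omega> \<theta> = id_blinfun"
| "iterate (Suc n) \<omega> \<theta> = fibre (\<omega> (int n)) (orbit \<omega> \<theta> n) o\<^sub>L iterate n \<omega> \<theta>"

text \<open>For ergodic \<open>\<nu>\<close> the limit exists almost everywhere by the subadditive ergodic theorem and is unique;
  for other \<open>\<nu>\<close> the value is not meaningful.\<close>

definition L1 :: "('d::finite, 'm::finite) cocycle measure \<Rightarrow> real" where
  "L1 \<nu> = (THE l. AE (\<omega>, \<theta>) in bernoulli_measure \<nu> \<Otimes>\<^sub>M torus_haar.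
     (\<lambda>n. 1 / real n * ln (norm (iterate n \<omega> \<theta>))) \<longlonglongrightarrow> l)"

end

theory Submission
  imports Defs
begin

text \<open>Write \<open>\<phi>\<^sub>n(\<omega>, \<theta>) = log \<parallel>A\<^sup>n(\<omega>)(\<theta>)\<parallel>\<close>.  A matrix of determinant one has norm at least one, so
\<open>0 \<le> \<phi>\<^sub>n \<le> n log L\<close>, and \<open>\<phi>\<close> is subadditive along the skew product.  The exponent \<open>L\<^sub>1\<close> of an
ergodic law is then \<open>inf\<^sub>n \<integral>\<phi>\<^sub>n / n\<close>, by the subadditive ergodic theorem.  For nonnegative bounded
\<open>\<phi>\<close> this theorem has a short proof (\<open>AE_tendsto_growth\<close>): if \<open>lim inf \<phi>\<^sub>n / n\<close> were below \<open>\<gamma>\<close>,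
then almost every orbit could be covered, up to a small proportion of times, by blocks on which
\<open>\<phi>\<close> grows at a rate below \<open>\<gamma>\<close>, and integration gives \<open>inf\<^sub>n \<integral>\<phi>\<^sub>n / n \<le> \<gamma>\<close>. Birkhoff's theorem is
the special case of additive sequences, and it gives the upper bound, since \<open>\<phi>\<^sub>n\<close> is at most \<open>1/N\<close>
times the Birkhoff sum of \<open>\<phi>\<^sub>N\<close>, up to a constant that depends on \<open>N\<close>.

Both assertions of the theorem follow from one estimate: for some block length \<open>N\<close> and every law
\<open>\<nu>\<close> that is \<open>W\<^sub>1\<close>-close to \<open>\<nu>\<^sub>0\<close>, the mean of \<open>\<phi>\<^sub>N(\<omega>, \<theta>)\<close> under \<open>\<nu>\<^sup>\<int>\<close> is at most
\<open>N (L\<^sub>1(\<nu>\<^sub>0) + \<epsilon>)\<close> for all \<open>\<theta>\<close> (\<open>uniform_block_estimate\<close>).  There are two steps.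

For \<open>\<nu>\<^sub>0\<close> itself (\<open>uniform_expected_growth\<close>), Birkhoff's theorem bounds the mean of \<open>1/n\<close> times
the Birkhoff sum of \<open>\<phi>\<^sub>N\<close> for almost every starting point \<open>\<theta>\<close>.  Translations are isometries of the
torus and \<open>\<nu>\<^sub>0\<close> has compact support, so these means are equicontinuous in \<open>\<theta>\<close>; a set of full Haar
measure is dense and the torus is compact, so the bound holds for all \<open>\<theta>\<close> at once.

For nearby laws (\<open>expected_log_norm_upper_semicontinuous\<close>), \<open>\<phi>\<^sub>N\<close> need not be a Lipschitz function
of the first \<open>N\<close> letters, but near the compact support of \<open>\<nu>\<^sub>0\<close> it is uniformly continuous.  It
therefore has a Lipschitz majorant that is almost equal to \<open>\<phi>\<^sub>N\<close> on that support, and the mean of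
a Lipschitz function changes by a controlled amount when the \<open>N\<close> factors of the product measure
are exchanged one at a time.

Upper semicontinuity is now immediate, because \<open>L\<^sub>1(\<nu>) \<le> \<integral>\<phi>\<^sub>N / N\<close>.  For the large deviations,
successive blocks of letters are independent and the block estimate is uniform in the starting
point, so exponential moments of \<open>\<phi>\<^sub>q\<^sub>N\<close> are bounded by the \<open>q\<close>-th power of a bound, uniform in
\<open>\<theta>\<close>, for those of \<open>\<phi>\<^sub>N\<close> (\<open>exp_moment_power\<close>), and Chernoff's bound applies
(\<open>large_deviation_bound\<close>).\<close>

section \<open>An ergodic theorem for bounded subadditive sequences\<close>

lemma ergodic_mapD:
  assumes "ergodic_map M f"
  shows "f \<in> measurable M M" "distr M M f = M"
    and "\<And>A. A \<in> sets M \<Longrightarrow> f -` A \<inter> space M = A \<Longrightarrow> measure M A = 0 \<or> measure M A = 1"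
  using assms by (auto simp: ergodic_map_def)

lemma funpow_measure_preserving:
  assumes "f \<in> measurable M M" "distr M M f = M"
  shows "f ^^ n \<in> measurable M M" "distr M M (f ^^ n) = M"
proof -
  show *: "f ^^ n \<in> measurable M M" for n
  proof (induction n)
    case (Suc n)
    show ?case using measurable_comp[OF Suc assms(1)] by (simp add: comp_def)
  qed simp
  show "distr M M (f ^^ n) = M"
  proof (induction n)
    case 0
    then show ?case by (simp add: id_def distr_id)
  next
    case (Suc n)
    have "distr M M (f \<circ> f ^^ n) = distr (distr M M (f ^^ n)) M f"
      by (rule distr_distr[symmetric]) (use * assms in auto)
    with Suc assms show ?case by (simp add: comp_def)
  qed
qed

lemma sum_orbit_add:
  "(\<Sum>j<m + n. g ((f ^^ j) x)) = (\<Sum>j<m. g ((f ^^ j) x)) + (\<Sum>j<n. g ((f ^^ j) ((f ^^ m) x)))"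
  for g :: "'a \<Rightarrow> real"
proof (induction n)
  case (Suc n)
  have "(f ^^ (m + n)) x = (f ^^ n) ((f ^^ m) x)"
    by (simp add: add.commute[of m] funpow_add)
  then show ?case using Suc by simp
qed simp

text \<open>Ergodicity only speaks of strictly invariant sets.  The increasing union of the preimages of
a forward invariant set is strictly invariant and has the same measure.\<close>

lemma forward_invariant_zero_one:
  assumes "prob_space M" "ergodic_map M f" and B: "B \<in> sets M"
    and inv: "\<And>x. x \<in> B \<Longrightarrow> f x \<in> B"
  shows "measure M B = 0 \<or> measure M B = 1"
proof -
  interpret prob_space M by fact
  note f = ergodic_mapD[OF assms(2)]
  note fn = funpow_measure_preserving[OF f(1,2)]
  define D where "D n = (f ^^ n) -` B \<inter> space M" for n
  have D_sets[measurable]: "D n \<in> sets M" for n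
    unfolding D_def using fn(1) B by (rule measurable_sets)
  have D_measure: "measure M (D n) = measure M B" for n
    using measure_distr[OF fn(1) B, of n] fn(2) by (simp add: D_def)
  have "incseq D"
    by (rule incseq_SucI) (auto simp: D_def inv)
  then have "(\<lambda>n. measure M (D n)) \<longlonglongrightarrow> measure M (\<Union>n. D n)"
    by (intro finite_Lim_measure_incseq) (auto simp: D_sets)
  then have eq: "measure M (\<Union>n. D n) = measure M B"
    unfolding D_measure using LIMSEQ_unique tendsto_const by blast
  have "f -` D n \<inter> space M = D (Suc n)" for n
    using measurable_space[OF f(1)] by (auto simp: D_def funpow_swap1)
  then have "f -` (\<Union>n. D n) \<inter> space M = (\<Union>n. D (Suc n))"
    by (simp only: vimage_UN) blast
  also have "\<dots> = (\<Union>n. D n)"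
  proof (rule antisym)
    show "(\<Union>n. D n) \<subseteq> (\<Union>n. D (Suc n))"
      using \<open>incseq D\<close> by (auto dest: incseq_SucD)
  qed blast
  finally show ?thesis
    using f(3)[of "\<Union>n. D n"] eq D_sets by (auto simp: sets.countable_UN)
qed

text \<open>The bound \<open>0 \<le> \<phi> n \<le> n C\<close> replaces the integrability condition of the general subadditive
theorem and makes the elementary covering argument below sufficient.\<close>

locale bounded_subadditive = prob_space M for M :: "'a measure" +
  fixes f :: "'a \<Rightarrow> 'a" and \<phi> :: "nat \<Rightarrow> 'a \<Rightarrow> real" and C :: real
  assumes ergodic: "ergodic_map M f"
    and meas[measurable]: "\<And>n. \<phi> n \<in> borel_measurable M"
    and nonneg: "\<And>n x. x \<in> space M \<Longrightarrow> 0 \<le> \<phi> n x"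
    and bound: "\<And>n x. x \<in> space M \<Longrightarrow> \<phi> n x \<le> real n * C"
    and subadd: "\<And>m n x. x \<in> space M \<Longrightarrow> \<phi> (m + n) x \<le> \<phi> m x + \<phi> n ((f ^^ m) x)"
begin

definition growth :: real where
  "growth = (INF n \<in> {1..}. (\<integral>x. \<phi> n x \<partial>M) / real n)"

lemma C_nonneg: "0 \<le> C"
  using not_empty nonneg[of _ 1] bound[of _ 1] by force

lemma funpow_measurable[measurable]: "f ^^ n \<in> measurable M M"
  and distr_funpow: "distr M M (f ^^ n) = M"
  using funpow_measure_preserving ergodic_mapD[OF ergodic] by blast+

lemma funpow_space: "x \<in> space M \<Longrightarrow> (f ^^ n) x \<in> space M"
  using measurable_space[OF funpow_measurable] .

lemma integrable_phi: "integrable M (\<phi> n)"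
  by (rule integrable_const_bound[of _ "real n * C"]) (use nonneg bound in \<open>auto intro!: AE_I2\<close>)

lemma integral_funpow:
  fixes g :: "'a \<Rightarrow> real"
  assumes "g \<in> borel_measurable M"
  shows "(\<integral>x. g ((f ^^ n) x) \<partial>M) = (\<integral>x. g x \<partial>M)"
  using integral_distr[OF funpow_measurable assms, of n] by (simp add: distr_funpow)

lemma integral_phi_nonneg: "0 \<le> (\<integral>x. \<phi> n x \<partial>M)"
  by (rule integral_nonneg_AE) (use nonneg in \<open>auto intro!: AE_I2\<close>)

lemma growth_le:
  assumes "1 \<le> n"
  shows "growth \<le> (\<integral>x. \<phi> n x \<partial>M) / real n"
  unfolding growth_def
  by (rule cINF_lower) (use assms integral_phi_nonneg in \<open>auto intro!: bdd_belowI2[of _ 0]\<close>)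

lemma growth_approx:
  assumes "growth < c"
  obtains n where "1 \<le> n" "(\<integral>x. \<phi> n x \<partial>M) < real n * c"
proof -
  obtain n where "1 \<le> n" "(\<integral>x. \<phi> n x \<partial>M) / real n < c"
    using assms unfolding growth_def
    by (subst (asm) cINF_less_iff) (use integral_phi_nonneg in \<open>auto intro!: bdd_belowI2[of _ 0]\<close>)
  then show thesis
    by (intro that[of n]) (auto simp: field_simps)
qed

text \<open>Walk along the orbit: at a point of \<open>E\<close>, jump ahead by a block on which \<open>\<phi>\<close> grows at rate at
most \<open>\<gamma>\<close>; at any other point, advance by one step at cost at most \<open>C\<close>; the last at most \<open>N\<close> steps
cost at most \<open>C N\<close>.\<close>

lemma covering_bound:
  fixes \<gamma> :: real and N :: nat
  defines "E \<equiv> {x \<in> space M. \<exists>n\<in>{1..N}. \<phi> n x \<le> real n * \<gamma>}"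
  assumes "0 \<le> \<gamma>" and "x \<in> space M"
  shows "\<phi> K x \<le> \<gamma> * real K + C * (\<Sum>j<K. indicator (space M - E) ((f ^^ j) x)) + C * real N"
  using \<open>x \<in> space M\<close>
proof (induction K arbitrary: x rule: less_induct)
  case (less K)
  define bad where "bad K x = (\<Sum>j<K. indicator (space M - E) ((f ^^ j) x) :: real)" for K x
  have bad_nonneg: "0 \<le> bad K x" for K x
    unfolding bad_def by (rule sum_nonneg) auto
  have bad_shift: "bad (m + n) x = bad m x + bad n ((f ^^ m) x)" for m n
    unfolding bad_def by (rule sum_orbit_add)
  have IH: "\<phi> n y \<le> \<gamma> * real n + C * bad n y + C * real N" if "n < K" "y \<in> space M" for n y
    using less.IH[OF that] by (simp add: bad_def)
  have "\<phi> K x \<le> \<gamma> * real K + C * bad K x + C * real N"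
  proof (cases "K \<le> N")
    case True
    then have "\<phi> K x \<le> C * real N"
      using bound[OF \<open>x \<in> space M\<close>, of K] mult_right_mono[of "real K" "real N" C] C_nonneg
      by (simp add: mult.commute)
    then show ?thesis
      using C_nonneg \<open>0 \<le> \<gamma>\<close> bad_nonneg[of K x] by (simp add: add_increasing)
  next
    case False
    show ?thesis
    proof (cases "x \<in> E")
      case True
      then obtain n where n: "1 \<le> n" "n \<le> N" "\<phi> n x \<le> real n * \<gamma>"
        by (auto simp: E_def)
      define k where "k = K - n"
      have k: "K = n + k" "k < K" using n False by (auto simp: k_def)
      have "\<phi> K x \<le> \<phi> n x + \<phi> k ((f ^^ n) x)"
        unfolding k(1) by (rule subadd[OF less.prems])
      also have "\<dots> \<le> real n * \<gamma> + (\<gamma> * real k + C * bad k ((f ^^ n) x) + C * real N)"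
        using n(3) IH[OF k(2) funpow_space[OF less.prems]] by (rule add_mono)
      also have "\<dots> \<le> \<gamma> * real K + C * bad K x + C * real N"
      proof -
        have "C * bad k ((f ^^ n) x) \<le> C * bad K x"
          using C_nonneg bad_nonneg[of n x] unfolding k(1) bad_shift by (intro mult_left_mono) auto
        then show ?thesis by (simp add: k(1) algebra_simps)
      qed
      finally show ?thesis .
    next
      case x: False
      define k where "k = K - 1"
      have k: "K = 1 + k" "k < K" using False by (auto simp: k_def)
      have "bad 1 x = 1" using x less.prems by (simp add: bad_def)
      have "\<phi> K x \<le> \<phi> 1 x + \<phi> k ((f ^^ 1) x)"
        unfolding k(1) by (rule subadd[OF less.prems])
      also have "\<dots> \<le> C + (\<gamma> * real k + C * bad k ((f ^^ 1) x) + C * real N)"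
        using bound[OF less.prems, of 1] IH[OF k(2) funpow_space[OF less.prems, of 1]] by simp
      also have "\<dots> \<le> \<gamma> * real K + C * bad K x + C * real N"
        unfolding k(1) bad_shift \<open>bad 1 x = 1\<close> using \<open>0 \<le> \<gamma>\<close> by (simp add: algebra_simps)
      finally show ?thesis .
    qed
  qed
  then show ?case by (simp add: bad_def)
qed

text \<open>Integration of the covering bound: bad times have frequency \<open>measure M (space M - E N)\<close>,
which tends to zero as \<open>N\<close> grows.\<close>

lemma growth_le_if_recurrently_small:
  assumes "0 \<le> \<gamma>" and small: "AE x in M. \<exists>n\<ge>1. \<phi> n x \<le> real n * \<gamma>"
  shows "growth \<le> \<gamma>"
proof -
  define E where "E N = {x \<in> space M. \<exists>n\<in>{1..N}. \<phi> n x \<le> real n * \<gamma>}" for N :: nat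
  have E_sets[measurable]: "E N \<in> sets M" for N
    unfolding E_def by measurable
  have step: "growth \<le> \<gamma> + C * measure M (space M - E N)" for N
  proof -
    let ?p = "measure M (space M - E N)"
    have le: "growth \<le> \<gamma> + C * ?p + C * real N * inverse (real (Suc k))" for k
    proof -
      define K where "K = Suc k"
      have orb: "integrable M (\<lambda>x. indicator (space M - E N) ((f ^^ j) x) :: real)" for j
        by (rule integrable_const_bound[of _ 1]) (auto split: split_indicator)
      have "(\<integral>x. \<phi> K x \<partial>M) \<le> (\<integral>x. \<gamma> * real K + C * (\<Sum>j<K. indicator (space M - E N) ((f ^^ j) x))
          + C * real N \<partial>M)"
        by (rule integral_mono)
          (use covering_bound[OF \<open>0 \<le> \<gamma>\<close>, of _ K N, folded E_def] orb in
            \<open>auto intro!: integrable_phi\<close>)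
      also have "\<dots> = \<gamma> * real K + C * (\<Sum>j<K. (\<integral>x. indicator (space M - E N) ((f ^^ j) x) \<partial>M)) + C * real N"
        by (simp add: orb prob_space)
      also have "\<dots> = \<gamma> * real K + C * (real K * ?p) + C * real N"
        by (subst integral_funpow) auto
      finally have "(\<integral>x. \<phi> K x \<partial>M) / real K \<le> \<gamma> + C * ?p + C * real N / real K"
      proof -
        assume le: "(\<integral>x. \<phi> K x \<partial>M) \<le> \<gamma> * real K + C * (real K * ?p) + C * real N"
        have "(\<integral>x. \<phi> K x \<partial>M) / real K \<le> (\<gamma> * real K + C * (real K * ?p) + C * real N) / real K"
          using le by (rule divide_right_mono) simp
        also have "\<dots> = \<gamma> + C * ?p + C * real N / real K"
          by (simp add: K_def add_divide_distrib)
        finally show ?thesis .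
      qed
      with growth_le[of K] show ?thesis by (simp add: K_def divide_inverse)
    qed
    have "(\<lambda>k. \<gamma> + C * ?p + C * real N * inverse (real (Suc k))) \<longlonglongrightarrow> \<gamma> + C * ?p + C * real N * 0"
      by (intro tendsto_intros LIMSEQ_inverse_real_of_nat)
    then show ?thesis
      using le by (simp add: LIMSEQ_le_const[OF _ exI[of _ 0]])
  qed
  have "incseq E"
    by (rule incseq_SucI) (force simp: E_def)
  have "measure M (\<Union>N. E N) = 1"
  proof -
    have "AE x in M. x \<in> (\<Union>N. E N)"
      using small AE_space by eventually_elim (simp add: E_def, meson atLeastAtMost_iff order_refl)
    then show ?thesis by (intro prob_eq_1[THEN iffD2]) auto
  qed
  moreover have "(\<lambda>N. measure M (E N)) \<longlonglongrightarrow> measure M (\<Union>N. E N)"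
    using \<open>incseq E\<close> by (intro finite_Lim_measure_incseq) auto
  ultimately have "(\<lambda>N. \<gamma> + C * (1 - measure M (E N))) \<longlonglongrightarrow> \<gamma> + C * (1 - 1)"
    by (intro tendsto_intros) simp
  then show ?thesis
    using step by (simp add: LIMSEQ_le_const[OF _ exI[of _ 0]] prob_compl)
qed

text \<open>Having asymptotic growth at least \<open>\<gamma>\<close> is a forward invariant property, hence holds almost
everywhere or almost nowhere, and the second case contradicts the previous lemma.  The slack
\<open>1 / Suc k\<close>, for all \<open>k\<close>, absorbs the bounded error \<open>\<phi> 1 x\<close> made by one step and so makes the
property invariant.\<close>

lemma AE_eventually_ge_up_to_reciprocal:
  assumes "\<gamma> < growth"
  shows "AE x in M. \<forall>k. eventually (\<lambda>n. real n * (\<gamma> - 1 / Suc k) \<le> \<phi> n x) sequentially"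
proof (cases "0 \<le> \<gamma>")
  case False
  have "real n * (\<gamma> - 1 / Suc k) \<le> \<phi> n x" if "x \<in> space M" for n k x
  proof -
    have "\<gamma> - 1 / Suc k \<le> 0" using False by (smt (verit) divide_nonneg_nonneg of_nat_0_le_iff)
    then have "real n * (\<gamma> - 1 / Suc k) \<le> 0" by (simp add: mult_nonneg_nonpos)
    also have "\<dots> \<le> \<phi> n x" by (rule nonneg[OF that])
    finally show ?thesis .
  qed
  then show ?thesis by (intro AE_I2) auto
next
  case True
  define B where "B = {x \<in> space M. \<forall>k. \<exists>n0. \<forall>n\<ge>n0. real n * (\<gamma> - 1 / Suc k) \<le> \<phi> n x}"
  have B[measurable]: "B \<in> sets M" unfolding B_def by measurable
  have "f x \<in> B" if "x \<in> B" for x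
  proof -
    have x: "x \<in> space M" using that by (simp add: B_def)
    have "\<exists>n0. \<forall>n\<ge>n0. real n * (\<gamma> - 1 / Suc k) \<le> \<phi> n (f x)" for k
    proof -
      obtain n0 where n0: "\<And>n. n \<ge> n0 \<Longrightarrow> real n * (\<gamma> - 1 / Suc (Suc k)) \<le> \<phi> n x"
      proof -
        have "\<exists>n0. \<forall>n\<ge>n0. real n * (\<gamma> - 1 / Suc (Suc k)) \<le> \<phi> n x"
          using \<open>x \<in> B\<close> unfolding B_def by (elim CollectE conjE) (erule spec)
        then show ?thesis using that by blast
      qed
      define d where "d = 1 / real (Suc k) - 1 / real (Suc (Suc k))"
      have "0 < d" by (simp add: d_def frac_less2)
      obtain n1 :: nat where n1: "(C + 1) / d < real n1" using reals_Archimedean2 by blast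
      have "real n * (\<gamma> - 1 / Suc k) \<le> \<phi> n (f x)" if "n \<ge> max n0 n1" for n
      proof -
        have "real (Suc n) * (\<gamma> - 1 / Suc (Suc k)) \<le> \<phi> (1 + n) x" using n0[of "Suc n"] that by simp
        also have "\<dots> \<le> C + \<phi> n (f x)"
          using subadd[OF x, of 1 n] bound[OF x, of 1] by simp
        finally have 1: "real (Suc n) * (\<gamma> - 1 / Suc (Suc k)) \<le> C + \<phi> n (f x)" .
        have "C + 1 \<le> real n1 * d" using n1 \<open>0 < d\<close> by (simp add: field_simps)
        also have "\<dots> \<le> real n * d" using that \<open>0 < d\<close> by (intro mult_right_mono) auto
        finally have 2: "C + 1 \<le> real n * d" .
        have "\<gamma> - 1 / Suc (Suc k) \<ge> - 1" using True by (smt (verit) divide_le_eq_1 of_nat_0_less_iff of_nat_1 of_nat_Suc zero_less_Suc of_nat_0_le_iff)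
        with 1 2 show ?thesis by (simp add: d_def algebra_simps add_divide_distrib)
      qed
      then show ?thesis by blast
    qed
    then show ?thesis using measurable_space[OF ergodic_mapD(1)[OF ergodic] x] by (simp add: B_def)
  qed
  then consider "measure M B = 0" | "measure M B = 1"
    using forward_invariant_zero_one[OF prob_space_axioms ergodic B] by blast
  then show ?thesis
  proof cases
    case 1
    then have "AE x in M. x \<notin> B" using prob_eq_0[OF B] by simp
    then have "AE x in M. \<exists>n\<ge>1. \<phi> n x \<le> real n * \<gamma>"
      using AE_space
    proof eventually_elim
      case (elim x)
      then obtain k where k: "\<And>n0. \<exists>n\<ge>n0. \<phi> n x < real n * (\<gamma> - 1 / Suc k)"
        by (auto simp: B_def not_le)
      obtain n where n: "n \<ge> 1" "\<phi> n x < real n * (\<gamma> - 1 / Suc k)" using k by blast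
      moreover have "real n * (\<gamma> - 1 / Suc k) \<le> real n * \<gamma>" by (intro mult_left_mono) auto
      ultimately show ?case by (intro exI[of _ n] conjI) linarith+
    qed
    from growth_le_if_recurrently_small[OF True this] assms show ?thesis by simp
  next
    case 2
    then have "AE x in M. x \<in> B" using prob_eq_1[OF B] by simp
    then show ?thesis by eventually_elim (auto simp: B_def eventually_sequentially)
  qed
qed

lemma AE_eventually_ge:
  "AE x in M. \<forall>c<growth. eventually (\<lambda>n. real n * c \<le> \<phi> n x) sequentially"
proof -
  have "AE x in M. \<forall>q::rat. of_rat q < growth \<longrightarrow>
      (\<forall>k. eventually (\<lambda>n. real n * (of_rat q - 1 / Suc k) \<le> \<phi> n x) sequentially)"
    by (subst AE_all_countable) (use AE_eventually_ge_up_to_reciprocal in auto)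
  then show ?thesis
  proof eventually_elim
    case (elim x)
    show ?case
    proof (intro allI impI)
      fix c assume "c < growth"
      then obtain q where q: "c < of_rat q" "of_rat q < growth" using of_rat_dense by blast
      then obtain k where k: "inverse (real (Suc k)) < of_rat q - c"
        using reals_Archimedean[of "of_rat q - c"] by auto
      have "eventually (\<lambda>n. real n * (of_rat q - 1 / Suc k) \<le> \<phi> n x) sequentially"
        using elim q by blast
      then show "eventually (\<lambda>n. real n * c \<le> \<phi> n x) sequentially"
      proof eventually_elim
        case (elim n)
        have "real n * c \<le> real n * (of_rat q - 1 / Suc k)"
          by (rule mult_left_mono) (use k in \<open>auto simp: divide_inverse\<close>)
        with elim show ?case by linarith
      qed
    qed
  qed
qed

end

text \<open>The upper half of Birkhoff's theorem for a bounded function \<open>g\<close> is the lower bound above for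
the nonnegative additive sequence of the sums of \<open>C - g\<close>.\<close>

lemma AE_birkhoff_sum_le:
  fixes g :: "'a \<Rightarrow> real"
  assumes "prob_space M" "ergodic_map M f" and g[measurable]: "g \<in> borel_measurable M"
    and g_bd: "\<And>x. x \<in> space M \<Longrightarrow> 0 \<le> g x \<and> g x \<le> C"
  shows "AE x in M. \<forall>c > (\<integral>x. g x \<partial>M). eventually (\<lambda>n. (\<Sum>j<n. g ((f ^^ j) x)) \<le> real n * c) sequentially"
proof -
  interpret prob_space M by fact
  note fn[measurable] = funpow_measure_preserving[OF ergodic_mapD(1,2)[OF assms(2)]]
  have sp: "(f ^^ n) x \<in> space M" if "x \<in> space M" for n x
    using measurable_space[OF fn(1) that] .
  have int_g: "integrable M (\<lambda>x. g ((f ^^ j) x))" for j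
    by (rule integrable_const_bound[of _ C]) (use g_bd sp in \<open>auto intro!: AE_I2\<close>)
  interpret S: bounded_subadditive M f "\<lambda>n x. \<Sum>j<n. C - g ((f ^^ j) x)" C
  proof
    show "(\<Sum>j<m + n. C - g ((f ^^ j) x)) \<le> (\<Sum>j<m. C - g ((f ^^ j) x)) + (\<Sum>j<n. C - g ((f ^^ j) ((f ^^ m) x)))"
      for m n x
      by (simp only: sum_orbit_add[of "\<lambda>y. C - g y"] order_refl)
    show "(\<Sum>j<n. C - g ((f ^^ j) x)) \<le> real n * C" if "x \<in> space M" for n x
    proof -
      have "(\<Sum>j<n. C - g ((f ^^ j) x)) \<le> (\<Sum>j<n. C)"
        by (rule sum_mono) (use g_bd sp that in auto)
      then show ?thesis by simp
    qed
  qed (use assms(2) g_bd sp in \<open>auto intro!: sum_nonneg\<close>)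
  have int_eq: "(\<integral>x. (\<Sum>j<n. C - g ((f ^^ j) x)) \<partial>M) = real n * (C - (\<integral>x. g x \<partial>M))" for n
    using S.integral_funpow[OF g] by (simp add: int_g prob_space)
  have "C - (\<integral>x. g x \<partial>M) \<le> S.growth"
    unfolding S.growth_def int_eq by (rule cINF_greatest) auto
  from S.AE_eventually_ge show ?thesis
  proof eventually_elim
    case (elim x)
    show ?case
    proof (intro allI impI)
      fix c assume "(\<integral>x. g x \<partial>M) < c"
      then have "C - c < S.growth" using \<open>C - (\<integral>x. g x \<partial>M) \<le> S.growth\<close> by simp
      with elim have "eventually (\<lambda>n. real n * (C - c) \<le> (\<Sum>j<n. C - g ((f ^^ j) x))) sequentially"
        by blast
      then show "eventually (\<lambda>n. (\<Sum>j<n. g ((f ^^ j) x)) \<le> real n * c) sequentially"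
        by eventually_elim (simp add: sum_subtractf algebra_simps)
    qed
  qed
qed

context bounded_subadditive
begin

text \<open>Splitting off a first block of length \<open>N\<close> at each of \<open>N\<close> consecutive starting points
collects \<open>\<phi> N\<close> along \<open>N\<close> consecutive points of the orbit; the induction on \<open>n\<close> continues from the
next \<open>N\<close> points.\<close>

lemma sum_over_block_le:
  assumes "x \<in> space M"
  shows "(\<Sum>i<N. \<phi> n ((f ^^ i) x)) \<le> (\<Sum>j<n. \<phi> N ((f ^^ j) x)) + real N * real N * C"
  using assms
proof (induction n arbitrary: x rule: less_induct)
  case (less n)
  have sp: "(f ^^ i) x \<in> space M" for i using less.prems by (rule funpow_space)
  show ?case
  proof (cases "n < N \<or> N = 0")
    case True
    have "(\<Sum>i<N. \<phi> n ((f ^^ i) x)) \<le> (\<Sum>i<N. real N * C)"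
    proof (rule sum_mono)
      fix i assume "i \<in> {..<N}"
      then have "n \<le> N" using True by auto
      then have "real n * C \<le> real N * C" using C_nonneg by (intro mult_right_mono) auto
      then show "\<phi> n ((f ^^ i) x) \<le> real N * C" using bound[OF sp, of n i] by linarith
    qed
    moreover have "0 \<le> (\<Sum>j<n. \<phi> N ((f ^^ j) x))" by (rule sum_nonneg) (use nonneg sp in auto)
    ultimately show ?thesis by simp
  next
    case False
    define k where "k = n - N"
    have k: "n = N + k" "k < n" using False by (auto simp: k_def)
    have "(\<Sum>i<N. \<phi> n ((f ^^ i) x)) \<le> (\<Sum>i<N. \<phi> N ((f ^^ i) x) + \<phi> k ((f ^^ i) ((f ^^ N) x)))"
    proof (rule sum_mono)
      fix i
      have "(f ^^ N) ((f ^^ i) x) = (f ^^ i) ((f ^^ N) x)"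
        by (metis add.commute comp_apply funpow_add)
      then show "\<phi> n ((f ^^ i) x) \<le> \<phi> N ((f ^^ i) x) + \<phi> k ((f ^^ i) ((f ^^ N) x))"
        using subadd[OF sp[of i], of N k] by (simp add: k(1))
    qed
    also have "\<dots> \<le> (\<Sum>i<N. \<phi> N ((f ^^ i) x)) +
        ((\<Sum>j<k. \<phi> N ((f ^^ j) ((f ^^ N) x))) + real N * real N * C)"
      using less.IH[OF k(2) sp[of N]] by (simp only: sum.distrib add_left_mono)
    also have "\<dots> = (\<Sum>j<n. \<phi> N ((f ^^ j) x)) + real N * real N * C"
      unfolding k(1) sum_orbit_add by simp
    finally show ?thesis .
  qed
qed

text \<open>Averaging over the \<open>N\<close> possible phases of a decomposition into blocks of length \<open>N\<close> compares
\<open>\<phi> n\<close> with a Birkhoff sum of \<open>\<phi> N\<close> over all times.\<close>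

lemma block_average_bound:
  assumes x: "x \<in> space M"
  shows "real N * \<phi> n x \<le> (\<Sum>j<n. \<phi> N ((f ^^ j) x)) + 2 * real N * real N * C"
proof (cases "n < N")
  case True
  have "real N * \<phi> n x \<le> real N * (real n * C)" using bound[OF x] by (intro mult_left_mono) auto
  also have "\<dots> \<le> real N * (real N * C)" using True C_nonneg by (intro mult_left_mono mult_right_mono) auto
  also have "\<dots> \<le> 2 * real N * real N * C" using C_nonneg by simp
  also have "\<dots> \<le> (\<Sum>j<n. \<phi> N ((f ^^ j) x)) + 2 * real N * real N * C"
    using nonneg[OF funpow_space[OF x]] by (simp add: sum_nonneg)
  finally show ?thesis .
next
  case False
  define k where "k = n - N"
  have k: "n = N + k" using False by (simp add: k_def)
  have each: "\<phi> n x \<le> \<phi> k ((f ^^ i) x) + real N * C" if "i < N" for i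
  proof -
    have "\<phi> n x = \<phi> (i + (k + (N - i))) x" using k that by (simp add: add.commute add.left_commute)
    also have "\<dots> \<le> \<phi> i x + \<phi> (k + (N - i)) ((f ^^ i) x)" by (rule subadd[OF x])
    also have "\<dots> \<le> real i * C + (\<phi> k ((f ^^ i) x) + \<phi> (N - i) ((f ^^ k) ((f ^^ i) x)))"
      by (intro add_mono bound subadd x funpow_space)
    also have "\<dots> \<le> real i * C + (\<phi> k ((f ^^ i) x) + real (N - i) * C)"
      by (intro add_mono order_refl bound x funpow_space)
    also have "\<dots> = \<phi> k ((f ^^ i) x) + real N * C" using that by (simp add: of_nat_diff algebra_simps)
    finally show ?thesis .
  qed
  have "real N * \<phi> n x = (\<Sum>i<N. \<phi> n x)" by simp
  also have "\<dots> \<le> (\<Sum>i<N. \<phi> k ((f ^^ i) x) + real N * C)" by (rule sum_mono) (use each in auto)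
  also have "\<dots> \<le> (\<Sum>j<k. \<phi> N ((f ^^ j) x)) + 2 * real N * real N * C"
    using sum_over_block_le[OF x, where N = N and n = k] by (simp add: sum.distrib algebra_simps)
  also have "(\<Sum>j<k. \<phi> N ((f ^^ j) x)) \<le> (\<Sum>j<n. \<phi> N ((f ^^ j) x))"
    by (rule sum_mono2) (use nonneg[OF funpow_space[OF x]] k in auto)
  finally show ?thesis by simp
qed

text \<open>Kingman's theorem for bounded subadditive sequences.  The lower bound comes from coverings,
the upper bound from Birkhoff's theorem for \<open>\<phi> N\<close> with a nearly optimal \<open>N\<close>.\<close>

theorem AE_tendsto_growth:
  "AE x in M. (\<lambda>n. \<phi> n x / real n) \<longlonglongrightarrow> growth"
proof -
  have up: "AE x in M. \<forall>N. \<forall>c > (\<integral>x. \<phi> N x \<partial>M). eventually (\<lambda>n. (\<Sum>j<n. \<phi> N ((f ^^ j) x)) \<le> real n * c) sequentially"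
  proof (subst AE_all_countable, intro allI)
    fix N
    show "AE x in M. \<forall>c > (\<integral>x. \<phi> N x \<partial>M). eventually (\<lambda>n. (\<Sum>j<n. \<phi> N ((f ^^ j) x)) \<le> real n * c) sequentially"
      by (rule AE_birkhoff_sum_le[OF prob_space_axioms ergodic meas, where C = "real N * C"]) (simp add: nonneg bound)
  qed
  from up AE_eventually_ge AE_space show ?thesis
  proof eventually_elim
    case (elim x)
    show ?case
    proof (rule order_tendstoI)
      fix a assume "a < growth"
      then obtain c where c: "a < c" "c < growth" using dense by blast
      from elim(2) c have "eventually (\<lambda>n. real n * c \<le> \<phi> n x) sequentially" by blast
      then show "eventually (\<lambda>n. a < \<phi> n x / real n) sequentially"
        using eventually_gt_at_top[of 0]
      proof eventually_elim
        case (elim n)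
        then have "c \<le> \<phi> n x / real n" by (simp add: field_simps)
        with c show ?case by simp
      qed
    next
      fix a assume "growth < a"
      then obtain b where b: "growth < b" "b < a" using dense by blast
      obtain N where N: "1 \<le> N" "(\<integral>x. \<phi> N x \<partial>M) < real N * b" using growth_approx[OF b(1)] .
      have "(\<lambda>n. b + 2 * real N * C / real n) \<longlonglongrightarrow> b + 0"
        by (intro tendsto_intros tendsto_divide_0[OF tendsto_const] filterlim_at_top_imp_at_infinity
            filterlim_real_sequentially)
      then have "eventually (\<lambda>n. b + 2 * real N * C / real n < a) sequentially"
        using b(2) by (auto dest: order_tendstoD)
      moreover have "eventually (\<lambda>n. (\<Sum>j<n. \<phi> N ((f ^^ j) x)) \<le> real n * (real N * b)) sequentially"
        using elim(1) N by blast
      ultimately show "eventually (\<lambda>n. \<phi> n x / real n < a) sequentially"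
        using eventually_gt_at_top[of 0]
      proof eventually_elim
        case 3: (elim n)
        have "real N * \<phi> n x \<le> real N * (real n * b + 2 * real N * C)"
          using block_average_bound[OF elim(3), of N n] 3(2) by (simp add: algebra_simps)
        then have "\<phi> n x \<le> real n * b + 2 * real N * C" using N(1) by simp
        then have "\<phi> n x / real n \<le> b + 2 * real N * C / real n" using 3(3) by (simp add: field_simps)
        with 3(1) show ?case by simp
      qed
    qed
  qed
qed

end
section \<open>Separability of matrices and of the torus\<close>

text \<open>Measurability of sums in the torus and of products of operators rests on the equality of
Borel and product \<open>\<sigma>\<close>-algebras, which needs countable bases.\<close>

lemma countable_basis_if_dense:
  fixes D :: "'a::metric_space set"
  assumes "countable D" and dense: "\<And>x e. 0 < e \<Longrightarrow> \<exists>d\<in>D. dist d x < e"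
  shows "\<exists>B::'a set set. countable B \<and> open = generate_topology B"
proof (intro exI conjI)
  let ?B = "(\<lambda>(d, q). ball d q) ` (D \<times> (\<rat> :: real set))"
  show "countable ?B"
    using \<open>countable D\<close> countable_rat by blast
  have "topological_basis ?B"
  proof (rule topological_basisI)
    fix S :: "'a set" and x assume "open S" "x \<in> S"
    then obtain e where e: "0 < e" "ball x e \<subseteq> S" by (meson openE)
    obtain q where q: "q \<in> \<rat>" "0 < q" "q < e / 2"
      using Rats_dense_in_real[of 0 "e / 2"] e by auto
    obtain d where d: "d \<in> D" "dist d x < q" using dense q by blast
    have "ball d q \<subseteq> ball x e"
    proof
      fix y assume "y \<in> ball d q"
      then have "dist x y < q + q"
        using d dist_triangle[of x y d] by (simp add: dist_commute)
      then show "y \<in> ball x e" using q by simp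
    qed
    with d q e show "\<exists>B'\<in>?B. x \<in> B' \<and> B' \<subseteq> S"
      by (intro bexI[of _ "ball d q"]) auto
  qed auto
  then show "open = generate_topology ?B" by (rule topological_basis_imp_subbasis)
qed

lemma heine_borel_countable_dense:
  "\<exists>D :: 'a::heine_borel set. countable D \<and> (\<forall>x. \<forall>e>0. \<exists>d\<in>D. dist d x < e)"
proof -
  obtain a :: 'a where True by simp
  have "\<forall>n k :: nat. \<exists>F. finite F \<and> cball a (real n) \<subseteq> (\<Union>x\<in>F. ball x (inverse (real (Suc k))))"
    using compact_cball[of a] unfolding compact_eq_totally_bounded by auto
  then obtain F where F: "\<And>n k. finite (F n k)"
    "\<And>n k. cball a (real n) \<subseteq> (\<Union>x\<in>F n k. ball x (inverse (real (Suc k))))"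
    by metis
  let ?D = "\<Union>n k. F n k"
  have "countable ?D" using F(1) by (simp add: countable_finite)
  moreover have "\<exists>d\<in>?D. dist d x < e" if "0 < e" for x e
  proof -
    obtain n :: nat where n: "dist a x \<le> real n" using real_arch_simple by blast
    obtain k where k: "inverse (real (Suc k)) < e" using reals_Archimedean[OF \<open>0 < e\<close>] by blast
    have "x \<in> cball a (real n)" using n by simp
    then obtain d where "d \<in> F n k" "dist d x < inverse (real (Suc k))" using F(2) by fastforce
    then show ?thesis using k by (intro bexI[of _ d]) auto
  qed
  ultimately show ?thesis by blast
qed

instance blinfun :: (euclidean_space, euclidean_space) second_countable_topology
proof
  show "\<exists>B::('a \<Rightarrow>\<^sub>L 'b) set set. countable B \<and> open = generate_topology B"
    using heine_borel_countable_dense[where 'a = "'a \<Rightarrow>\<^sub>L 'b"] countable_basis_if_dense by meson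
qed

instance circle :: second_countable_topology
proof
  have "\<exists>d\<in>to_circle ` \<rat>. dist d x < e" if "0 < e" for x :: circle and e
  proof -
    obtain r where r: "x = to_circle r" by (metis Quotient_circle Quotient_abs_rep)
    obtain q where q: "q \<in> \<rat>" "r < q" "q < r + e"
      using Rats_dense_in_real[of r "r + e"] \<open>0 < e\<close> by auto
    have "dist (to_circle q) x < e" using dist_to_circle_le[of q r] q by (simp add: r dist_real_def)
    then show ?thesis using q by blast
  qed
  then show "\<exists>B::circle set set. countable B \<and> open = generate_topology B"
    by (intro countable_basis_if_dense[of "to_circle ` \<rat>"]) (auto intro: countable_rat)
qed

text \<open>The class \<open>metric_space\<close> in the arity makes it compatible with the first countability that
vectors inherit from their metric.\<close>

instance vec :: ("{metric_space, second_countable_topology}", finite) second_countable_topology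
proof
  obtain B :: "'a set set" where B: "countable B" "topological_basis B"
    using ex_countable_basis by blast
  let ?box = "\<lambda>A :: 'b \<Rightarrow> 'a set. {y :: 'a ^ 'b. \<forall>i. y $ i \<in> A i}"
  let ?B = "?box ` (UNIV \<rightarrow>\<^sub>E B)"
  show "\<exists>B::('a, 'b) vec set set. countable B \<and> open = generate_topology B"
  proof (intro exI conjI)
    show "countable ?B" using B(1) by (intro countable_image countable_PiE) auto
    have "topological_basis ?B"
    proof (rule topological_basisI)
      fix S assume "S \<in> ?B"
      then obtain A where A: "S = ?box A" "\<And>i. A i \<in> B" by auto
      then show "open S"
        using topological_basis_open[OF B(2)] unfolding A(1) by (intro open_vector_box) auto
    next
      fix S :: "('a ^ 'b) set" and x assume "open S" "x \<in> S"
      then obtain A where A: "\<And>i. open (A i)" "\<And>i. x $ i \<in> A i" "\<And>y. (\<forall>i. y $ i \<in> A i) \<Longrightarrow> y \<in> S"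
        unfolding open_vec_def by metis
      have "\<forall>i. \<exists>b\<in>B. x $ i \<in> b \<and> b \<subseteq> A i"
        using A topological_basisE[OF B(2)] by metis
      then obtain b where "\<And>i. b i \<in> B \<and> x $ i \<in> b i \<and> b i \<subseteq> A i" by metis
      with A(3) show "\<exists>B'\<in>?B. x \<in> B' \<and> B' \<subseteq> S"
        by (intro bexI[of _ "?box b"]) auto
    qed
    then show "open = generate_topology ?B" by (rule topological_basis_imp_subbasis)
  qed
qed

section \<open>The torus\<close>

lemma dist_circle_add_right: "dist (a + c) (b + c) = dist a (b :: circle)"
  by transfer simp

lemma dist_torus_add_right: "dist (a + c) (b + c) = dist a (b :: 'd::finite torus)"
  by (simp add: dist_vec_def dist_circle_add_right)

lemma dist_torus_add: "dist (a + c) (b + d) \<le> dist a b + dist c (d :: 'd::finite torus)"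
proof -
  have "dist (a + c) (b + d) \<le> dist (a + c) (b + c) + dist (b + c) (b + d)" by (rule dist_triangle)
  also have "dist (b + c) (b + d) = dist c d"
    using dist_torus_add_right[of c b d] by (simp add: add.commute)
  finally show ?thesis by (simp add: dist_torus_add_right)
qed

lemma borel_measurable_torus_add[measurable (raw)]:
  fixes f g :: "'a \<Rightarrow> 'd::finite torus"
  assumes "f \<in> borel_measurable M" "g \<in> borel_measurable M"
  shows "(\<lambda>x. f x + g x) \<in> borel_measurable M"
proof (rule borel_measurable_continuous_Pair[OF assms])
  show "continuous_on UNIV (\<lambda>x :: 'd torus \<times> 'd torus. fst x + snd x)"
  proof (rule lipschitz_on_continuous_on[of 2], rule lipschitz_onI)
    fix x y :: "'d torus \<times> 'd torus"
    show "dist (fst x + snd x) (fst y + snd y) \<le> 2 * dist x y"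
      using dist_torus_add[of "fst x" "snd x" "fst y" "snd y"] dist_fst_le[of x y] dist_snd_le[of x y]
      by linarith
  qed simp
qed

lemma torus_proj_fundamental_domain:
  fixes \<theta> :: "'d::finite torus"
  obtains x :: "real ^ 'd" where "\<forall>i. 0 \<le> x $ i \<and> x $ i < 1" "torus_proj x = \<theta>"
proof
  let ?x = "\<chi> i. frac (rep_circle (\<theta> $ i))"
  have "to_circle (frac r) = to_circle r" for r
    by (subst circle.abs_eq_iff) (simp add: frac_def)
  moreover have "to_circle (rep_circle z) = z" for z
    by (metis Quotient_circle Quotient_abs_rep)
  ultimately show "torus_proj ?x = \<theta>"
    by (simp add: torus_proj_def vec_eq_iff)
qed (simp_all add: frac_lt_1)

lemma compact_torus: "compact (UNIV :: 'd::finite torus set)"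
proof -
  have "torus_proj ` cbox (0 :: real ^ 'd) 1 = UNIV"
  proof (rule antisym)
    show "UNIV \<subseteq> torus_proj ` cbox (0 :: real ^ 'd) 1"
    proof
      fix \<theta> :: "'d torus"
      obtain x :: "real ^ 'd" where x: "\<forall>i. 0 \<le> x $ i \<and> x $ i < 1" "torus_proj x = \<theta>"
        by (rule torus_proj_fundamental_domain)
      then show "\<theta> \<in> torus_proj ` cbox (0 :: real ^ 'd) 1"
        by (intro image_eqI[of _ _ x]) (auto simp: mem_box_cart less_imp_le)
    qed
  qed simp
  then show ?thesis
    using compact_continuous_image[OF continuous_on_torus_proj compact_cbox] by metis
qed

lemma sets_torus_haar[measurable_cong, simp]: "sets torus_haar = sets borel"
  by (simp add: torus_haar_def)

lemma space_torus_haar[simp]: "space torus_haar = UNIV"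
  by (simp add: torus_haar_def)

text \<open>A preimage of \<open>U\<close> meets the half-open unit cube, which lies in the closure of the open cube;
so it contains a nonempty open subset of the open cube.\<close>

lemma torus_haar_open_pos:
  fixes U :: "'d::finite torus set"
  assumes "open U" "U \<noteq> {}"
  shows "0 < emeasure torus_haar U"
proof -
  let ?Q = "{x :: real ^ 'd. \<forall>i. 0 \<le> x $ i \<and> x $ i < 1}"
  obtain \<theta> where "\<theta> \<in> U" using assms by blast
  obtain x :: "real ^ 'd" where x: "\<forall>i. 0 \<le> x $ i \<and> x $ i < 1" "torus_proj x = \<theta>"
    by (rule torus_proj_fundamental_domain)
  let ?V = "torus_proj -` U :: (real ^ 'd) set"
  have V: "open ?V" using \<open>open U\<close> continuous_on_torus_proj by (rule open_vimage)
  have "x \<in> closure (box 0 1)"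
    using x by (subst closure_box) (auto simp: mem_box_cart less_imp_le interval_ne_empty_cart)
  moreover have "x \<in> ?V" using x \<open>\<theta> \<in> U\<close> by simp
  ultimately have "?V \<inter> box 0 1 \<noteq> {}"
    using V open_Int_closure_eq_empty by blast
  then have pos: "emeasure lborel (?V \<inter> box 0 1) \<noteq> 0"
  proof -
    have "open (?V \<inter> box 0 1)" using V by (intro open_Int) auto
    then have "\<not> negligible (?V \<inter> box 0 1)"
      using \<open>?V \<inter> box 0 1 \<noteq> {}\<close> by (rule open_not_negligible)
    moreover have "?V \<inter> box 0 1 \<in> sets lborel"
      using \<open>open (?V \<inter> box 0 1)\<close> by simp
    ultimately show ?thesis
      using null_sets_completionI[of "?V \<inter> box 0 1" lborel]
      by (auto simp: negligible_iff_null_sets null_sets_def)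
  qed
  have Q: "?Q \<in> sets lborel" by measurable
  have m: "torus_proj \<in> restrict_space lborel ?Q \<rightarrow>\<^sub>M borel"
    by (intro measurable_restrict_space1) (simp add: borel_measurable_continuous_onI continuous_on_torus_proj)
  have "emeasure torus_haar U = emeasure (restrict_space lborel ?Q) (torus_proj -` U \<inter> ?Q)"
    unfolding torus_haar_def using \<open>open U\<close>
    by (subst emeasure_distr[OF m]) (auto simp: space_restrict_space)
  also have "\<dots> = emeasure lborel (?V \<inter> ?Q)"
    using Q by (subst emeasure_restrict_space) auto
  also have "emeasure lborel (?V \<inter> box 0 1) \<le> \<dots>"
    using V Q by (intro emeasure_mono) (auto simp: mem_box_cart less_imp_le open_vimage)
  finally show ?thesis using pos by (metis zero_less_iff_neq_zero order_less_le_trans)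
qed

section \<open>Unimodular matrices have norm at least one\<close>

text \<open>Were the norm less than one, the powers of \<open>A\<close> would tend to zero, and so would their
determinants, which are all equal to one.\<close>

lemma norm_ge_1_if_det_1:
  fixes A :: "(real ^ 'm::finite) \<Rightarrow>\<^sub>L (real ^ 'm)"
  assumes "det (matrix (blinfun_apply A)) = 1"
  shows "1 \<le> norm A"
proof (rule ccontr)
  assume "\<not> 1 \<le> norm A"
  have lin: "linear (blinfun_apply B)" for B :: "(real ^ 'm) \<Rightarrow>\<^sub>L (real ^ 'm)"
    by (simp add: blinfun.bounded_linear_right bounded_linear.linear)
  define P where "P n = ((o\<^sub>L) A ^^ n) id_blinfun" for n
  have norm_P: "norm (P n) \<le> norm A ^ n" for n
  proof (induction n)
    case (Suc n)
    have "norm (P (Suc n)) \<le> norm A * norm (P n)" by (simp add: P_def norm_blinfun_compose)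
    also have "\<dots> \<le> norm A * norm A ^ n" using Suc by (intro mult_left_mono) auto
    finally show ?case by simp
  qed (simp add: P_def norm_blinfun_id_le)
  have det_P: "det (matrix (blinfun_apply (P n))) = 1" for n
  proof (induction n)
    case (Suc n)
    have "blinfun_apply (P (Suc n)) = blinfun_apply A \<circ> blinfun_apply (P n)"
      by (auto simp: fun_eq_iff P_def)
    then have "matrix (blinfun_apply (P (Suc n))) = matrix (blinfun_apply A) ** matrix (blinfun_apply (P n))"
      using matrix_compose[OF lin lin] by metis
    then show ?case using Suc assms by (simp add: det_mul)
  qed (simp add: P_def id_blinfun.rep_eq matrix_id_mat_1[unfolded id_def])
  have entry: "(\<lambda>n. matrix (blinfun_apply (P n)) $ i $ j) \<longlonglongrightarrow> 0" for i j
  proof (rule Lim_null_comparison[OF always_eventually, rule_format])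
    show "norm (matrix (blinfun_apply (P n)) $ i $ j) \<le> norm A ^ n" for n
      using component_le_onorm[OF lin[of "P n"], of i j] norm_P[of n]
      by (simp add: norm_blinfun.rep_eq)
    show "(\<lambda>n. norm A ^ n) \<longlonglongrightarrow> 0"
      using \<open>\<not> 1 \<le> norm A\<close> by (intro LIMSEQ_power_zero) auto
  qed
  have "(\<lambda>n. det (matrix (blinfun_apply (P n)))) \<longlonglongrightarrow> (\<Sum>p | p permutes (UNIV :: 'm set). of_int (sign p) * (\<Prod>i\<in>(UNIV :: 'm set). 0))"
    unfolding det_def by (intro tendsto_intros entry)
  then have "(\<lambda>n. 1 :: real) \<longlonglongrightarrow> 0" by (simp add: det_P zero_power)
  then show False using LIMSEQ_unique tendsto_const zero_neq_one by metis
qed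

lemma abs_ln_diff_le:
  fixes a b :: real
  assumes "1 \<le> a" "1 \<le> b"
  shows "\<bar>ln a - ln b\<bar> \<le> \<bar>a - b\<bar>"
proof -
  have "ln a - ln b \<le> a - b" if "1 \<le> b" "b \<le> a" for a b :: real
  proof -
    have "ln a - ln b = ln (a / b)" using that by (simp add: ln_div)
    also have "\<dots> \<le> a / b - 1" using that by (intro ln_le_minus_one) simp
    also have "\<dots> = (a - b) / b" using that by (simp add: field_simps)
    also have "\<dots> \<le> (a - b) / 1" using that by (intro divide_left_mono) auto
    finally show ?thesis by simp
  qed
  from this[of a b] this[of b a] assms show ?thesis by (cases "b \<le> a") (auto simp: abs_if)
qed

section \<open>Cocycle iterates\<close>

lemma det_fibre: "det (matrix (blinfun_apply (apply_bcontfun (fibre x) \<theta>))) = 1"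
  using cocycle_pair[of x] by (simp add: fibre_def)

lemma det_iterate:
  fixes \<omega> :: "int \<Rightarrow> ('d::finite, 'm::finite) cocycle"
  shows "det (matrix (blinfun_apply (iterate n \<omega> \<theta>))) = 1"
proof (induction n)
  case (Suc n)
  have lin: "linear (blinfun_apply A)" for A :: "(real ^ 'm) \<Rightarrow>\<^sub>L (real ^ 'm)"
    by (simp add: blinfun.bounded_linear_right bounded_linear.linear)
  have "blinfun_apply (iterate (Suc n) \<omega> \<theta>) =
      blinfun_apply (apply_bcontfun (fibre (\<omega> (int n))) (orbit \<omega> \<theta> n)) \<circ> blinfun_apply (iterate n \<omega> \<theta>)"
    by (auto simp: fun_eq_iff)
  then have *: "matrix (blinfun_apply (iterate (Suc n) \<omega> \<theta>)) =
      matrix (blinfun_apply (apply_bcontfun (fibre (\<omega> (int n))) (orbit \<omega> \<theta> n))) ** matrix (blinfun_apply (iterate n \<omega> \<theta>))"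
    using matrix_compose[OF lin lin] by metis
  then show ?case
    by (simp only: * det_mul det_fibre Suc mult_1)
qed (simp add: id_blinfun.rep_eq matrix_id_mat_1[unfolded id_def])

lemma norm_iterate_ge_1: "1 \<le> norm (iterate n \<omega> \<theta>)"
  by (rule norm_ge_1_if_det_1) (rule det_iterate)

lemma norm_fibre_apply_le: "norm (apply_bcontfun (fibre x) \<theta>) \<le> norm (fibre x)"
  by (rule norm_bounded)

lemma norm_iterate_le:
  assumes "0 \<le> L" "\<And>i. i < n \<Longrightarrow> \<omega> (int i) \<in> cocycles_le L"
  shows "norm (iterate n \<omega> \<theta>) \<le> L ^ n"
  using assms(2)
proof (induction n)
  case (Suc n)
  have "norm (iterate (Suc n) \<omega> \<theta>) \<le> norm (apply_bcontfun (fibre (\<omega> (int n))) (orbit \<omega> \<theta> n)) * norm (iterate n \<omega> \<theta>)"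
    by (simp add: norm_blinfun_compose)
  also have "\<dots> \<le> L * L ^ n"
    using Suc norm_fibre_apply_le[of "\<omega> (int n)"] \<open>0 \<le> L\<close>
    by (intro mult_mono) (auto simp: cocycles_le_def intro: order_trans)
  finally show ?case by simp
qed (simp add: norm_blinfun_id_le)

definition log_norm :: "nat \<Rightarrow> (int \<Rightarrow> ('d::finite, 'm::finite) cocycle) \<Rightarrow> 'd torus \<Rightarrow> real" where
  "log_norm n \<omega> \<theta> = ln (norm (iterate n \<omega> \<theta>))"

lemma log_norm_nonneg: "0 \<le> log_norm n \<omega> \<theta>"
  by (simp add: log_norm_def norm_iterate_ge_1)

lemma log_norm_le:
  assumes "1 \<le> L" "\<And>i. i < n \<Longrightarrow> \<omega> (int i) \<in> cocycles_le L"
  shows "log_norm n \<omega> \<theta> \<le> real n * ln L"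
proof -
  have "log_norm n \<omega> \<theta> \<le> ln (L ^ n)"
    unfolding log_norm_def using norm_iterate_le[of L n \<omega> \<theta>] norm_iterate_ge_1[of n \<omega> \<theta>] assms
    by (subst ln_le_cancel_iff) auto
  then show ?thesis using assms by (simp add: ln_realpow)
qed

lemma orbit_add: "orbit \<omega> \<theta> (m + n) = orbit (\<lambda>i. \<omega> (i + int m)) (orbit \<omega> \<theta> m) n"
proof -
  have "(\<Sum>i<m + n. freq (\<omega> (int i))) = (\<Sum>i<m. freq (\<omega> (int i))) + (\<Sum>i<n. freq (\<omega> (int i + int m)))"
    by (induction n) (simp_all add: add.assoc add.commute[of "int m"])
  then show ?thesis by (simp add: orbit_def add.assoc)
qed

lemma iterate_add:
  "iterate (m + n) \<omega> \<theta> = iterate n (\<lambda>i. \<omega> (i + int m)) (orbit \<omega> \<theta> m) o\<^sub>L iterate m \<omega> \<theta>"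
proof (induction n)
  case (Suc n)
  then show ?case by (simp add: orbit_add add.commute[of "int m"] blinfun_eqI)
qed (simp add: blinfun_eqI)

lemma log_norm_add:
  "log_norm (m + n) \<omega> \<theta> \<le> log_norm m \<omega> \<theta> + log_norm n (\<lambda>i. \<omega> (i + int m)) (orbit \<omega> \<theta> m)"
proof -
  let ?A = "iterate m \<omega> \<theta>" and ?B = "iterate n (\<lambda>i. \<omega> (i + int m)) (orbit \<omega> \<theta> m)"
  have pos: "0 < norm (iterate k w z)" for k and w :: "int \<Rightarrow> ('a, 'b) cocycle" and z
    using norm_iterate_ge_1[of k w z] by linarith
  have "ln (norm (?B o\<^sub>L ?A)) \<le> ln (norm ?B * norm ?A)"
    using pos[of "m + n" \<omega> \<theta>] pos[of m \<omega> \<theta>] pos[of n "\<lambda>i. \<omega> (i + int m)" "orbit \<omega> \<theta> m"]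
    by (subst ln_le_cancel_iff) (auto simp: iterate_add norm_blinfun_compose)
  also have "\<dots> = ln (norm ?A) + ln (norm ?B)"
    using pos[of m \<omega> \<theta>] pos[of n "\<lambda>i. \<omega> (i + int m)" "orbit \<omega> \<theta> m"] by (subst ln_mult) auto
  finally show ?thesis by (simp add: log_norm_def iterate_add)
qed

lemma orbit_cong: "(\<And>i. i < n \<Longrightarrow> \<omega> (int i) = \<omega>' (int i)) \<Longrightarrow> orbit \<omega> \<theta> n = orbit \<omega>' \<theta> n"
  by (simp add: orbit_def)

lemma iterate_cong: "(\<And>i. i < n \<Longrightarrow> \<omega> (int i) = \<omega>' (int i)) \<Longrightarrow> iterate n \<omega> \<theta> = iterate n \<omega>' \<theta>"
proof (induction n)
  case (Suc n)
  then show ?case using orbit_cong[of n \<omega> \<omega>' \<theta>] by simp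
qed simp

lemma skew_funpow: "(skew ^^ n) (\<omega>, \<theta>) = ((\<lambda>i. \<omega> (i + int n)), orbit \<omega> \<theta> n)"
proof (induction n)
  case (Suc n)
  then show ?case
    by (simp add: skew_def shift_def orbit_def algebra_simps)
qed (simp add: orbit_def)

lemma dist_orbit_same_le: "dist (orbit \<omega> \<theta> n) (orbit \<omega> \<theta>' n) = dist \<theta> \<theta>'"
  by (simp add: orbit_def dist_torus_add_right)

section \<open>Measurability\<close>

lemma freq_lipschitz: "1-lipschitz_on UNIV freq"
  by (rule lipschitz_onI) (simp_all add: dist_cocycle_def)

lemma dist_fibre_apply_le: "dist (apply_bcontfun (fibre x) \<theta>) (apply_bcontfun (fibre y) \<theta>) \<le> dist x y"
  using dist_bounded[of "fibre x" \<theta> "fibre y"] zero_le_dist[of "freq x" "freq y"]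
  unfolding dist_cocycle_def by linarith

lemma borel_measurable_freq[measurable]: "freq \<in> borel_measurable borel"
  by (intro borel_measurable_continuous_onI lipschitz_on_continuous_on[OF freq_lipschitz])

text \<open>The matrix \<open>A(\<theta>)\<close> is continuous in each of \<open>A\<close> and \<open>\<theta>\<close>.  As \<open>\<theta>\<close> ranges over a separable
space, approximating it by simple functions gives joint measurability.\<close>

lemma borel_measurable_fibre_apply[measurable (raw)]:
  fixes X :: "'a \<Rightarrow> ('d::finite, 'm::finite) cocycle"
  assumes X[measurable]: "X \<in> borel_measurable N" and T: "T \<in> borel_measurable N"
  shows "(\<lambda>x. apply_bcontfun (fibre (X x)) (T x)) \<in> borel_measurable N"
proof -
  obtain F where F: "\<And>i. simple_function N (F i)" "\<And>x. x \<in> space N \<Longrightarrow> (\<lambda>i. F i x) \<longlonglongrightarrow> T x"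
    using borel_measurable_implies_sequence_metric[OF T] by blast
  show ?thesis
  proof (rule borel_measurable_LIMSEQ_metric)
    fix i
    show "(\<lambda>x. apply_bcontfun (fibre (X x)) (F i x)) \<in> borel_measurable N"
    proof (rule measurable_compose_countable'[where I = "F i ` space N"])
      fix \<theta> :: "'d torus"
      have "1-lipschitz_on UNIV (\<lambda>x :: ('d, 'm) cocycle. apply_bcontfun (fibre x) \<theta>)"
        by (rule lipschitz_onI) (simp_all add: dist_fibre_apply_le)
      then have "(\<lambda>x :: ('d, 'm) cocycle. apply_bcontfun (fibre x) \<theta>) \<in> borel_measurable borel"
        by (intro borel_measurable_continuous_onI lipschitz_on_continuous_on)
      then show "(\<lambda>x. apply_bcontfun (fibre (X x)) \<theta>) \<in> borel_measurable N"
        by measurable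
    next
      have "finite (F i ` space N)" using F(1) by (simp add: simple_function_def)
      then show "F i \<in> N \<rightarrow>\<^sub>M count_space (F i ` space N)" "countable (F i ` space N)"
        using F(1)[of i] by (auto simp: measurable_count_space_eq2 simple_function_def countable_finite)
    qed
  next
    fix x assume "x \<in> space N"
    have "continuous_on UNIV (apply_bcontfun (fibre (X x)))" by simp
    from continuous_on_tendsto_compose[OF this F(2)[OF \<open>x \<in> space N\<close>]]
    show "(\<lambda>i. apply_bcontfun (fibre (X x)) (F i x)) \<longlonglongrightarrow> apply_bcontfun (fibre (X x)) (T x)"
      by simp
  qed
qed

lemma borel_measurable_blinfun_compose[measurable (raw)]:
  fixes f :: "'a \<Rightarrow> ('c::euclidean_space \<Rightarrow>\<^sub>L 'e::euclidean_space)" and g :: "'a \<Rightarrow> ('b::euclidean_space \<Rightarrow>\<^sub>L 'c)"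
  assumes "f \<in> borel_measurable M" "g \<in> borel_measurable M"
  shows "(\<lambda>x. f x o\<^sub>L g x) \<in> borel_measurable M"
  by (rule borel_measurable_continuous_Pair[OF assms]) (intro continuous_intros)

lemma borel_measurable_iterate:
  fixes W :: "'a \<Rightarrow> int \<Rightarrow> ('d::finite, 'm::finite) cocycle"
  assumes W[measurable]: "\<And>i. (\<lambda>x. W x (int i)) \<in> borel_measurable N" and T[measurable]: "T \<in> borel_measurable N"
  shows borel_measurable_orbit: "(\<lambda>x. orbit (W x) (T x) n) \<in> borel_measurable N"
    and "(\<lambda>x. iterate n (W x) (T x)) \<in> borel_measurable N"
    and "(\<lambda>x. log_norm n (W x) (T x)) \<in> borel_measurable N"
proof -
  have orbit_Suc: "orbit \<omega> \<theta> (Suc n) = orbit \<omega> \<theta> n + freq (\<omega> (int n))" for \<omega> :: "int \<Rightarrow> ('d, 'm) cocycle" and \<theta> n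
    by (simp add: orbit_def add.assoc)
  show o[measurable]: "(\<lambda>x. orbit (W x) (T x) n) \<in> borel_measurable N" for n
  proof (induction n)
    case 0
    then show ?case by (simp add: orbit_def)
  next
    case (Suc n)
    note [measurable] = Suc
    show ?case unfolding orbit_Suc by measurable
  qed
  show [measurable]: "(\<lambda>x. iterate n (W x) (T x)) \<in> borel_measurable N"
    by (induction n) simp_all
  show "(\<lambda>x. log_norm n (W x) (T x)) \<in> borel_measurable N"
    unfolding log_norm_def by measurable
qed

section \<open>Uniform continuity of the iterates\<close>

lemma compact_equicontinuous:
  fixes K :: "('d::finite, 'm::finite) cocycle set"
  assumes "compact K" "0 < \<eta>"
  obtains r where "0 < r" "\<And>x \<theta> \<theta>'. x \<in> K \<Longrightarrow> dist \<theta> \<theta>' < r \<Longrightarrow>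
    dist (apply_bcontfun (fibre x) \<theta>) (apply_bcontfun (fibre x) \<theta>') < \<eta>"
proof -
  obtain F where F: "finite F" "K \<subseteq> (\<Union>x\<in>F. ball x (\<eta> / 3))"
    using \<open>compact K\<close> \<open>0 < \<eta>\<close> unfolding compact_eq_totally_bounded by (meson divide_pos_pos zero_less_numeral)
  have "\<exists>r>0. \<forall>\<theta> \<theta>'. dist \<theta> \<theta>' < r \<longrightarrow>
      dist (apply_bcontfun (fibre x) \<theta>) (apply_bcontfun (fibre x) \<theta>') < \<eta> / 3" for x :: "('d, 'm) cocycle"
  proof -
    have "uniformly_continuous_on UNIV (apply_bcontfun (fibre x))"
      by (rule compact_uniformly_continuous[OF _ compact_torus]) simp
    from uniformly_continuous_onE[OF this, of "\<eta> / 3"] \<open>0 < \<eta>\<close>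
    obtain r where "0 < r" "\<And>\<theta> \<theta>'. dist \<theta>' \<theta> < r \<Longrightarrow>
      dist (apply_bcontfun (fibre x) \<theta>') (apply_bcontfun (fibre x) \<theta>) < \<eta> / 3" by auto
    then show ?thesis by blast
  qed
  then obtain R :: "('d, 'm) cocycle \<Rightarrow> real" where R: "\<And>x. 0 < R x" "\<And>x \<theta> \<theta>'. dist \<theta> \<theta>' < R x \<Longrightarrow>
      dist (apply_bcontfun (fibre x) \<theta>) (apply_bcontfun (fibre x) \<theta>') < \<eta> / 3"
    by metis
  define r where "r = Min (insert 1 (R ` F))"
  show thesis
  proof
    show "0 < r" using F R(1) by (simp add: r_def)
    fix x and \<theta> \<theta>' :: "'d torus" assume "x \<in> K" "dist \<theta> \<theta>' < r"
    then obtain z where z: "z \<in> F" "dist z x < \<eta> / 3" using F by auto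
    have "r \<le> R z" using F z by (simp add: r_def)
    then have "dist (apply_bcontfun (fibre z) \<theta>) (apply_bcontfun (fibre z) \<theta>') < \<eta> / 3"
      using \<open>dist \<theta> \<theta>' < r\<close> by (intro R) simp
    moreover have "dist (apply_bcontfun (fibre x) t) (apply_bcontfun (fibre z) t) < \<eta> / 3" for t
      using dist_fibre_apply_le[of x t z] z(2) by (simp add: dist_commute)
    ultimately have "dist (apply_bcontfun (fibre x) \<theta>) (apply_bcontfun (fibre x) \<theta>') < \<eta> / 3 + \<eta> / 3 + \<eta> / 3"
      by (smt (verit) dist_commute dist_triangle)
    then show "dist (apply_bcontfun (fibre x) \<theta>) (apply_bcontfun (fibre x) \<theta>') < \<eta>" by simp
  qed
qed

lemma dist_orbit_le:
  "dist (orbit \<omega> \<theta> n) (orbit \<omega>' \<theta>' n) \<le> dist \<theta> \<theta>' + (\<Sum>i<n. dist (\<omega> (int i)) (\<omega>' (int i)))"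
proof (induction n)
  case (Suc n)
  have S: "orbit w t (Suc n) = orbit w t n + freq (w (int n))" for w :: "int \<Rightarrow> ('a, 'b) cocycle" and t
    by (simp add: orbit_def add.assoc)
  have "dist (freq (\<omega> (int n))) (freq (\<omega>' (int n))) \<le> dist (\<omega> (int n)) (\<omega>' (int n))"
    by (simp add: dist_cocycle_def)
  then show ?case
    using Suc dist_torus_add[of "orbit \<omega> \<theta> n" "freq (\<omega> (int n))" "orbit \<omega>' \<theta>' n" "freq (\<omega>' (int n))"]
    unfolding S by simp
qed (simp add: orbit_def)

text \<open>Only the reference word \<open>p\<close> has to lie in the compact set; the word \<open>y\<close> is merely close to
it.  This asymmetry is essential, since laws near a given one need not live near its support.  In
the induction step, the norms \<open>L\<close> of the last factor and \<open>L ^ N\<close> of the earlier product determine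
how the tolerance \<open>\<eta>\<close> is shared.\<close>

lemma iterate_uniformly_continuous_near_compact:
  fixes K :: "('d::finite, 'm::finite) cocycle set"
  assumes "compact K" "K \<subseteq> cocycles_le L" "1 \<le> L" "0 < \<eta>"
  shows "\<exists>r>0. \<forall>p y \<theta> \<theta>'. (\<forall>i<N. p (int i) \<in> K \<and> y (int i) \<in> cocycles_le L \<and> dist (y (int i)) (p (int i)) < r)
    \<longrightarrow> dist \<theta>' \<theta> < r \<longrightarrow> dist (iterate N y \<theta>') (iterate N p \<theta>) < \<eta>"
  using \<open>0 < \<eta>\<close>
proof (induction N arbitrary: \<eta>)
  case 0
  then show ?case by (auto intro: exI[of _ 1])
next
  case (Suc N)
  have LN: "1 \<le> L ^ N" using \<open>1 \<le> L\<close> by simp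
  have "0 < \<eta> / (2 * L)" using Suc.prems \<open>1 \<le> L\<close> by simp
  from Suc.IH[OF this] obtain r1 where r1: "0 < r1" "\<forall>p y \<theta> \<theta>'. (\<forall>i<N. p (int i) \<in> K \<and> y (int i) \<in> cocycles_le L \<and> dist (y (int i)) (p (int i)) < r1)
    \<longrightarrow> dist \<theta>' \<theta> < r1 \<longrightarrow> dist (iterate N y \<theta>') (iterate N p \<theta>) < \<eta> / (2 * L)"
    by blast
  obtain r2 where r2: "0 < r2" "\<And>x \<theta> \<theta>'. x \<in> K \<Longrightarrow> dist \<theta> \<theta>' < r2 \<Longrightarrow>
    dist (apply_bcontfun (fibre x) \<theta>) (apply_bcontfun (fibre x) \<theta>') < \<eta> / (4 * L ^ N)"
    by (rule compact_equicontinuous[OF \<open>compact K\<close>, of "\<eta> / (4 * L ^ N)"]) (use Suc.prems LN in auto)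
  define r where "r = min r1 (min (r2 / real (N + 1)) (\<eta> / (4 * L ^ N)))"
  show ?case
  proof (intro exI[of _ r] conjI allI impI)
    show "0 < r" using r1 r2 Suc.prems LN by (simp add: r_def)
    fix p y :: "int \<Rightarrow> ('d, 'm) cocycle" and \<theta> \<theta>' :: "'d torus"
    assume close: "\<forall>i<Suc N. p (int i) \<in> K \<and> y (int i) \<in> cocycles_le L \<and> dist (y (int i)) (p (int i)) < r"
      and \<theta>: "dist \<theta>' \<theta> < r"
    define A where "A = apply_bcontfun (fibre (p (int N))) (orbit p \<theta> N)"
    define A' where "A' = apply_bcontfun (fibre (y (int N))) (orbit y \<theta>' N)"
    define B where "B = iterate N p \<theta>"
    define B' where "B' = iterate N y \<theta>'"
    have B: "norm (B' - B) < \<eta> / (2 * L)"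
      using r1(2)[rule_format, of p y \<theta>' \<theta>] close \<theta> by (simp add: B_def B'_def r_def dist_norm)
    have "dist (orbit y \<theta>' N) (orbit p \<theta> N) \<le> dist \<theta>' \<theta> + (\<Sum>i<N. dist (y (int i)) (p (int i)))"
      by (rule dist_orbit_le)
    also have "\<dots> < r + (\<Sum>i<N. r)"
      using \<theta> close by (intro add_less_le_mono sum_mono) (auto intro: less_imp_le)
    also have "\<dots> = real (N + 1) * r" by (simp add: algebra_simps)
    also have "\<dots> \<le> real (N + 1) * (r2 / real (N + 1))" by (rule mult_left_mono) (simp_all add: r_def)
    finally have "dist (orbit y \<theta>' N) (orbit p \<theta> N) < r2" by simp
    then have "dist (apply_bcontfun (fibre (p (int N))) (orbit y \<theta>' N)) A < \<eta> / (4 * L ^ N)"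
      unfolding A_def using close by (intro r2) auto
    moreover have "dist A' (apply_bcontfun (fibre (p (int N))) (orbit y \<theta>' N)) < \<eta> / (4 * L ^ N)"
    proof -
      have "dist A' (apply_bcontfun (fibre (p (int N))) (orbit y \<theta>' N)) \<le> dist (y (int N)) (p (int N))"
        unfolding A'_def by (rule dist_fibre_apply_le)
      also have "\<dots> < \<eta> / (4 * L ^ N)" using close by (simp add: r_def)
      finally show ?thesis .
    qed
    ultimately have "dist A' A < \<eta> / (4 * L ^ N) + \<eta> / (4 * L ^ N)"
      using dist_triangle[of A' A "apply_bcontfun (fibre (p (int N))) (orbit y \<theta>' N)"] by linarith
    then have A: "norm (A' - A) < \<eta> / (2 * L ^ N)" by (simp add: dist_norm)
    have nB': "norm B' \<le> L ^ N"
      unfolding B'_def using \<open>1 \<le> L\<close> close by (intro norm_iterate_le) auto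
    have nA: "norm A \<le> L"
      unfolding A_def using close assms(2) norm_fibre_apply_le[of "p (int N)" "orbit p \<theta> N"]
      by (force simp: cocycles_le_def)
    have "norm ((A' o\<^sub>L B') - (A o\<^sub>L B)) = norm (((A' - A) o\<^sub>L B') + (A o\<^sub>L (B' - B)))"
      by (simp add: bounded_bilinear.diff_left[OF bounded_bilinear_blinfun_compose]
          bounded_bilinear.diff_right[OF bounded_bilinear_blinfun_compose])
    also have "\<dots> \<le> norm (A' - A) * norm B' + norm A * norm (B' - B)"
      by (intro order_trans[OF norm_triangle_ineq] add_mono norm_blinfun_compose)
    also have "\<dots> \<le> norm (A' - A) * L ^ N + L * norm (B' - B)"
      using nA nB' by (intro add_mono mult_left_mono mult_right_mono) auto
    also have "\<dots> < \<eta> / (2 * L ^ N) * L ^ N + L * (\<eta> / (2 * L))"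
      using A B \<open>1 \<le> L\<close> LN by (intro add_strict_mono mult_strict_right_mono mult_strict_left_mono) auto
    also have "\<dots> = \<eta>" using \<open>1 \<le> L\<close> LN by simp
    finally show "dist (iterate (Suc N) y \<theta>') (iterate (Suc N) p \<theta>) < \<eta>"
      by (simp add: dist_norm A_def A'_def B_def B'_def)
  qed
qed

lemma log_norm_uniformly_continuous_near_compact:
  fixes K :: "('d::finite, 'm::finite) cocycle set"
  assumes "compact K" "K \<subseteq> cocycles_le L" "1 \<le> L" "0 < \<eta>"
  shows "\<exists>r>0. \<forall>p y \<theta> \<theta>'. (\<forall>i<N. p (int i) \<in> K \<and> y (int i) \<in> cocycles_le L \<and> dist (y (int i)) (p (int i)) < r)
    \<longrightarrow> dist \<theta>' \<theta> < r \<longrightarrow> \<bar>log_norm N y \<theta>' - log_norm N p \<theta>\<bar> < \<eta>"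
proof -
  have "\<bar>log_norm N y \<theta>' - log_norm N p \<theta>\<bar> \<le> dist (iterate N y \<theta>') (iterate N p \<theta>)"
    for p y :: "int \<Rightarrow> ('d, 'm) cocycle" and \<theta> \<theta>'
  proof -
    have "\<bar>log_norm N y \<theta>' - log_norm N p \<theta>\<bar> \<le> \<bar>norm (iterate N y \<theta>') - norm (iterate N p \<theta>)\<bar>"
      unfolding log_norm_def by (rule abs_ln_diff_le) (rule norm_iterate_ge_1)+
    then show ?thesis
      using norm_triangle_ineq3[of "iterate N y \<theta>'" "iterate N p \<theta>"] unfolding dist_norm by linarith
  qed
  then show ?thesis
    using iterate_uniformly_continuous_near_compact[OF assms, of N] by (meson le_less_trans)
qed

section \<open>Laws of random quasiperiodic cocycles\<close>

locale cocycle_law =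
  fixes \<nu> :: "('d::finite, 'm::finite) cocycle measure" and L :: real
  assumes law: "\<nu> \<in> Prob_c (cocycles_le L)"
begin

sublocale \<nu>: prob_space \<nu>
  using law by (simp add: Prob_c_def)

lemma sets_law: "sets \<nu> = sets (restrict_space borel (cocycles_le L))"
  using law by (simp add: Prob_c_def)

lemma space_law: "space \<nu> = cocycles_le L"
  using sets_eq_imp_space_eq[OF sets_law] by (simp add: space_restrict_space)

lemma L_ge_1: "1 \<le> L"
proof -
  obtain x :: "('d, 'm) cocycle" where "x \<in> cocycles_le L" using \<nu>.not_empty space_law by blast
  then have "norm (apply_bcontfun (fibre x) 0) \<le> L"
    using norm_fibre_apply_le[of x 0] by (simp add: cocycles_le_def)
  moreover have "1 \<le> norm (apply_bcontfun (fibre x) 0)"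
    by (rule norm_ge_1_if_det_1) (rule det_fibre)
  ultimately show ?thesis by linarith
qed

lemma id_measurable: "(\<lambda>x. x) \<in> \<nu> \<rightarrow>\<^sub>M borel"
  by (subst measurable_cong_sets[OF sets_law refl]) (auto intro: measurable_restrict_space1)

sublocale B: product_prob_space "\<lambda>_. \<nu>" "UNIV :: int set"
  by unfold_locales

abbreviation B where "B \<equiv> bernoulli_measure \<nu>"

lemma B_eq: "B = PiM UNIV (\<lambda>_. \<nu>)"
  by (simp add: bernoulli_measure_def)

sublocale BP: prob_space B
  unfolding B_eq by (rule B.prob_space_axioms)

lemma B_coordinate_law: "(\<lambda>\<omega>. \<omega> i) \<in> B \<rightarrow>\<^sub>M \<nu>"
  unfolding B_eq by measurable

lemma B_coordinate[measurable]: "(\<lambda>\<omega>. \<omega> i) \<in> borel_measurable B"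
  using measurable_compose[OF B_coordinate_law id_measurable] .

lemma B_space: "\<omega> \<in> space B \<Longrightarrow> \<omega> i \<in> cocycles_le L"
  using measurable_space[OF B_coordinate_law] space_law by blast

lemma borel_measurable_log_norm_shift[measurable]:
  "(\<lambda>\<omega>. log_norm n (\<lambda>i. \<omega> (i + k)) (orbit \<omega> \<theta> j)) \<in> borel_measurable B"
  "(\<lambda>p. log_norm n (\<lambda>i. fst p (i + k)) (orbit (fst p) (snd p) j)) \<in> borel_measurable (B \<Otimes>\<^sub>M torus_haar)"
  by (intro borel_measurable_iterate borel_measurable_orbit; measurable)+

lemma borel_measurable_log_norm[measurable]:
  "(\<lambda>\<omega>. log_norm n \<omega> \<theta>) \<in> borel_measurable B"
  "(\<lambda>p. log_norm n (fst p) (snd p)) \<in> borel_measurable (B \<Otimes>\<^sub>M torus_haar)"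
  by (intro borel_measurable_iterate; measurable)+

lemma shifted_log_norm_le: "\<omega> \<in> space B \<Longrightarrow> log_norm n (\<lambda>i. \<omega> (i + k)) \<theta> \<le> real n * ln L"
  by (intro log_norm_le L_ge_1 B_space)

lemma log_norm_le_of_law: "\<omega> \<in> space B \<Longrightarrow> log_norm n \<omega> \<theta> \<le> real n * ln L"
  by (intro log_norm_le L_ge_1 B_space)

lemma integrable_shifted_log_norm: "integrable B (\<lambda>\<omega>. log_norm n (\<lambda>i. \<omega> (i + k)) (orbit \<omega> \<theta> j))"
  by (rule BP.integrable_const_bound[of _ "real n * ln L"])
    (use shifted_log_norm_le in \<open>auto intro!: AE_I2 simp: abs_of_nonneg log_norm_nonneg\<close>)

lemma integrable_log_norm: "integrable B (\<lambda>\<omega>. log_norm n \<omega> \<theta>)"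
  by (rule BP.integrable_const_bound[of _ "real n * ln L"])
    (use log_norm_le_of_law in \<open>auto intro!: AE_I2 simp: abs_of_nonneg log_norm_nonneg\<close>)

lemma compact_support:
  obtains K where "compact K" "K \<subseteq> cocycles_le L" "AE x in \<nu>. x \<in> K" "AE \<omega> in B. \<forall>i. \<omega> i \<in> K"
proof -
  obtain K where K: "compact K" "K \<subseteq> cocycles_le L" "measure \<nu> K = 1"
    using law by (auto simp: Prob_c_def)
  have "K \<in> sets \<nu>"
    by (rule ccontr) (use K(3) measure_notin_sets in force)
  then have AE: "AE x in \<nu>. x \<in> K" using K(3) \<nu>.prob_eq_1 by blast
  have "AE \<omega> in B. \<forall>i. \<omega> i \<in> K"
    unfolding B_eq by (subst AE_all_countable) (use AE in \<open>auto intro!: AE_PiM_component \<nu>.prob_space_axioms\<close>)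
  with K AE show thesis using that by blast
qed

end

locale ergodic_law = cocycle_law \<nu> L for \<nu> :: "('d::finite, 'm::finite) cocycle measure" and L +
  assumes ergodic_law: "ergodic_map (bernoulli_measure \<nu> \<Otimes>\<^sub>M torus_haar) skew"
begin

sublocale haar: prob_space "torus_haar :: 'd torus measure"
  by (rule prob_space_torus_haar)

sublocale P: pair_prob_space B "torus_haar :: 'd torus measure" ..

sublocale S: bounded_subadditive "B \<Otimes>\<^sub>M torus_haar" skew "\<lambda>n p. log_norm n (fst p) (snd p)" "ln L"
proof
  show "ergodic_map (B \<Otimes>\<^sub>M torus_haar) skew" by (rule ergodic_law)
  show "log_norm n (fst x) (snd x) \<le> real n * ln L" if "x \<in> space (B \<Otimes>\<^sub>M torus_haar)" for n x
    using that by (auto simp: space_pair_measure intro: log_norm_le_of_law)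
  show "log_norm (m + n) (fst x) (snd x)
      \<le> log_norm m (fst x) (snd x) + log_norm n (fst ((skew ^^ m) x)) (snd ((skew ^^ m) x))" for m n x
    using log_norm_add[of m n "fst x" "snd x"] skew_funpow[of m "fst x" "snd x"] by simp
qed (simp_all add: log_norm_nonneg)

lemma L1_eq_growth: "L1 \<nu> = S.growth"
  unfolding L1_def
proof (rule the_equality)
  show *: "AE (\<omega>, \<theta>) in B \<Otimes>\<^sub>M torus_haar. (\<lambda>n. 1 / real n * ln (norm (iterate n \<omega> \<theta>))) \<longlonglongrightarrow> S.growth"
    using S.AE_tendsto_growth by (simp add: split_beta' log_norm_def)
  fix l assume l: "AE (\<omega>, \<theta>) in B \<Otimes>\<^sub>M torus_haar. (\<lambda>n. 1 / real n * ln (norm (iterate n \<omega> \<theta>))) \<longlonglongrightarrow> l"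
  have "AE p in B \<Otimes>\<^sub>M (torus_haar :: 'd torus measure). l = S.growth"
    using AE_conjI[OF * l] by (rule eventually_mono) (auto intro: LIMSEQ_unique)
  then show "l = S.growth" by simp
qed

lemma growth_le_if_uniform:
  assumes "1 \<le> N" "\<And>\<theta>. (\<integral>\<omega>. log_norm N \<omega> \<theta> \<partial>B) \<le> real N * c"
  shows "S.growth \<le> c"
proof -
  have int: "integrable (B \<Otimes>\<^sub>M torus_haar) (case_prod (\<lambda>\<omega> \<theta>. log_norm N \<omega> \<theta>))"
    using S.integrable_phi[of N] by (simp add: split_beta')
  have "(\<integral>p. log_norm N (fst p) (snd p) \<partial>(B \<Otimes>\<^sub>M torus_haar)) = (\<integral>\<theta>. (\<integral>\<omega>. log_norm N \<omega> \<theta> \<partial>B) \<partial>torus_haar)"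
    using P.integral_snd[OF int] by (simp add: split_beta')
  also have "\<dots> \<le> (\<integral>\<theta>. real N * c \<partial>(torus_haar :: 'd torus measure))"
    by (rule integral_mono) (use P.integrable_snd[OF int] assms in simp_all)
  also have "\<dots> = real N * c" using haar.prob_space by simp
  finally have "(\<integral>p. log_norm N (fst p) (snd p) \<partial>(B \<Otimes>\<^sub>M torus_haar)) / real N \<le> c"
    using assms(1) by (simp add: field_simps)
  with S.growth_le[OF assms(1)] show ?thesis by simp
qed

text \<open>The passage from almost every \<open>\<theta>\<close> to all \<open>\<theta>\<close>.  It works with the Birkhoff sums \<open>T n\<close> of a
fixed \<open>log_norm N\<close> rather than with \<open>log_norm n\<close>: the averages \<open>T n / n\<close> share one modulus of
continuity in \<open>\<theta>\<close>, because all points of the orbit of \<open>\<theta>\<close> move rigidly with \<open>\<theta>\<close>, whereas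
\<open>log_norm n / n\<close> need not.\<close>

lemma uniform_expected_growth:
  assumes "0 < \<eta>"
  obtains N where "1 \<le> N" "\<And>\<theta>. (\<integral>\<omega>. log_norm N \<omega> \<theta> \<partial>B) \<le> real N * (S.growth + \<eta>)"
proof -
  \<comment> \<open>The errors, relative to \<open>N\<close>, are \<open>\<eta> / 4\<close> for the choice of \<open>N\<close>, \<open>\<eta> / 8\<close> for the time average, \<open>\<eta> / 8\<close> for the
      change of base point, and \<open>\<eta> / 2\<close> for the boundary terms of the blocks.\<close>
  obtain N where N: "1 \<le> N"
    "(\<integral>p. log_norm N (fst p) (snd p) \<partial>(B \<Otimes>\<^sub>M torus_haar)) < real N * (S.growth + \<eta> / 4)"
    using S.growth_approx[of "S.growth + \<eta> / 4"] assms by auto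
  define c where "c = real N * (S.growth + \<eta> / 4)"
  have "0 < c" using N(2) S.integral_phi_nonneg[of N] by (simp add: c_def)
  define T where "T n \<omega> \<theta> = (\<Sum>j<n. log_norm N (\<lambda>i. \<omega> (i + int j)) (orbit \<omega> \<theta> j))"
    for n :: nat and \<omega> :: "int \<Rightarrow> ('d, 'm) cocycle" and \<theta>
  have T_skew: "T n (fst p) (snd p) = (\<Sum>j<n. log_norm N (fst ((skew ^^ j) p)) (snd ((skew ^^ j) p)))" for n p
    unfolding T_def using skew_funpow[of _ "fst p" "snd p"] by simp
  have T_meas[measurable]: "(\<lambda>\<omega>. T n \<omega> \<theta>) \<in> borel_measurable B"
    "(\<lambda>p. T n (fst p) (snd p)) \<in> borel_measurable (B \<Otimes>\<^sub>M torus_haar)" for n \<theta>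
    unfolding T_def by measurable
  have T_int: "integrable B (\<lambda>\<omega>. T n \<omega> \<theta>)" for n \<theta>
    unfolding T_def by (intro Bochner_Integration.integrable_sum integrable_shifted_log_norm)
  have T_le: "T n \<omega> \<theta> \<le> real n * (real N * ln L)" if "\<omega> \<in> space B" for n \<omega> \<theta>
  proof -
    have "T n \<omega> \<theta> \<le> (\<Sum>j<n. real N * ln L)"
      unfolding T_def by (intro sum_mono shifted_log_norm_le that)
    then show ?thesis by simp
  qed
  have T_nonneg: "0 \<le> T n \<omega> \<theta>" for n \<omega> \<theta>
    unfolding T_def by (intro sum_nonneg log_norm_nonneg)
  have lnL: "0 \<le> ln L" using L_ge_1 by simp

  have "AE p in B \<Otimes>\<^sub>M torus_haar. eventually (\<lambda>n. T n (fst p) (snd p) \<le> real n * c) sequentially"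
  proof -
    have "AE p in B \<Otimes>\<^sub>M torus_haar. \<forall>c' > (\<integral>p. log_norm N (fst p) (snd p) \<partial>(B \<Otimes>\<^sub>M torus_haar)).
       eventually (\<lambda>n. (\<Sum>j<n. log_norm N (fst ((skew ^^ j) p)) (snd ((skew ^^ j) p))) \<le> real n * c') sequentially"
      by (rule AE_birkhoff_sum_le[OF P.prob_space_axioms ergodic_law, where C = "real N * ln L"])
        (auto simp: S.nonneg S.bound)
    then show ?thesis
      unfolding T_skew by eventually_elim (use N(2) in \<open>auto simp: c_def\<close>)
  qed
  then have "AE \<omega> in B. AE \<theta> in torus_haar. eventually (\<lambda>n. T n \<omega> \<theta> \<le> real n * c) sequentially"
    using P.AE_pair by fastforce
  then have "AE \<theta> in torus_haar. AE \<omega> in B. eventually (\<lambda>n. T n \<omega> \<theta> \<le> real n * c) sequentially"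
  proof (subst (asm) P.AE_commute)
    show "{p \<in> space (B \<Otimes>\<^sub>M torus_haar). \<forall>\<^sub>F n in sequentially. T n (fst p) (snd p) \<le> real n * c} \<in> sets (B \<Otimes>\<^sub>M torus_haar)"
      unfolding eventually_sequentially by measurable
  qed
  moreover define D where "D = {\<theta>. AE \<omega> in B. eventually (\<lambda>n. T n \<omega> \<theta> \<le> real n * c) sequentially}"
  ultimately have D: "AE \<theta> in torus_haar. \<theta> \<in> D" by simp

  define \<kappa> where "\<kappa> = real N * \<eta> / 8"
  have "0 < \<kappa>" using N(1) assms by (simp add: \<kappa>_def)
  have good: "eventually (\<lambda>n. (\<integral>\<omega>. T n \<omega> \<theta> \<partial>B) \<le> real n * (c + \<kappa>)) sequentially" if "\<theta> \<in> D" for \<theta>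
  proof -
    \<comment> \<open>Only an upper bound is known pointwise, so the positive part of the excess is what tends to zero.\<close>
    define h where "h n \<omega> = max 0 (T n \<omega> \<theta> / real n - c)" for n \<omega>
    have h_meas[measurable]: "h n \<in> borel_measurable B" for n unfolding h_def by measurable
    have h_le: "h n \<omega> \<le> real N * ln L" if "\<omega> \<in> space B" for n \<omega>
    proof (cases "n = 0")
      case False
      then have "T n \<omega> \<theta> / real n \<le> real N * ln L"
        using T_le[OF that, of n \<theta>] by (simp add: field_simps)
      then show ?thesis using \<open>0 < c\<close> lnL by (simp add: h_def)
    qed (use lnL \<open>0 < c\<close> in \<open>simp add: h_def\<close>)
    have h_int: "integrable B (h n)" for n
      by (rule BP.integrable_const_bound[of _ "real N * ln L"]) (use h_le in \<open>auto intro!: AE_I2 simp: h_def\<close>)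
    have "(\<lambda>n. \<integral>\<omega>. h n \<omega> \<partial>B) \<longlonglongrightarrow> (\<integral>\<omega>. 0 \<partial>B)"
    proof (rule integral_dominated_convergence[where w = "\<lambda>_. real N * ln L"])
      show "AE \<omega> in B. (\<lambda>n. h n \<omega>) \<longlonglongrightarrow> 0"
        using that unfolding D_def mem_Collect_eq
      proof eventually_elim
        case (elim \<omega>)
        have "eventually (\<lambda>n. h n \<omega> = 0) sequentially"
          using elim eventually_gt_at_top[of 0]
          by eventually_elim (simp add: h_def field_simps max_def)
        then show ?case by (rule tendsto_eventually)
      qed
      show "AE \<omega> in B. norm (h n \<omega>) \<le> real N * ln L" for n
        using h_le by (intro AE_I2) (auto simp: h_def)
    qed auto
    then have "eventually (\<lambda>n. (\<integral>\<omega>. h n \<omega> \<partial>B) < \<kappa>) sequentially"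
      using \<open>0 < \<kappa>\<close> by (auto dest: order_tendstoD)
    then show ?thesis
      using eventually_gt_at_top[of 0]
    proof eventually_elim
      case (elim n)
      have "(\<integral>\<omega>. T n \<omega> \<theta> \<partial>B) \<le> (\<integral>\<omega>. real n * (c + h n \<omega>) \<partial>B)"
      proof (rule integral_mono)
        fix \<omega>
        have "T n \<omega> \<theta> / real n \<le> c + h n \<omega>" by (simp add: h_def)
        then show "T n \<omega> \<theta> \<le> real n * (c + h n \<omega>)" using elim(2) by (simp add: field_simps)
      qed (use T_int h_int in auto)
      also have "\<dots> = real n * (c + (\<integral>\<omega>. h n \<omega> \<partial>B))" by (simp add: h_int BP.prob_space)
      also have "\<dots> \<le> real n * (c + \<kappa>)" using elim by (intro mult_left_mono) auto
      finally show ?case .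
    qed
  qed

  obtain K where K: "compact K" "K \<subseteq> cocycles_le L" and "AE x in \<nu>. x \<in> K" and K_AE: "AE \<omega> in B. \<forall>i. \<omega> i \<in> K"
    by (rule compact_support)
  from log_norm_uniformly_continuous_near_compact[OF K L_ge_1 \<open>0 < \<kappa>\<close>, of N]
  obtain r where r: "0 < r" "\<forall>p y \<theta> \<theta>'. (\<forall>i<N. p (int i) \<in> K \<and> y (int i) \<in> cocycles_le L \<and> dist (y (int i)) (p (int i)) < r)
    \<longrightarrow> dist \<theta>' \<theta> < r \<longrightarrow> \<bar>log_norm N y \<theta>' - log_norm N p \<theta>\<bar> < \<kappa>"
    by blast
  have equi: "(\<integral>\<omega>. T n \<omega> \<theta>' \<partial>B) \<le> (\<integral>\<omega>. T n \<omega> \<theta> \<partial>B) + real n * \<kappa>" if "dist \<theta>' \<theta> < r" for n \<theta> \<theta>'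
  proof -
    have "AE \<omega> in B. T n \<omega> \<theta>' \<le> T n \<omega> \<theta> + real n * \<kappa>"
      using K_AE
    proof eventually_elim
      case (elim \<omega>)
      have "T n \<omega> \<theta>' \<le> (\<Sum>j<n. log_norm N (\<lambda>i. \<omega> (i + int j)) (orbit \<omega> \<theta> j) + \<kappa>)"
        unfolding T_def
      proof (rule sum_mono)
        fix j
        have "\<bar>log_norm N (\<lambda>i. \<omega> (i + int j)) (orbit \<omega> \<theta>' j) - log_norm N (\<lambda>i. \<omega> (i + int j)) (orbit \<omega> \<theta> j)\<bar> < \<kappa>"
          using elim K(2) \<open>0 < r\<close> that by (intro r(2)[rule_format]) (auto simp: dist_orbit_same_le)
        then show "log_norm N (\<lambda>i. \<omega> (i + int j)) (orbit \<omega> \<theta>' j) \<le> log_norm N (\<lambda>i. \<omega> (i + int j)) (orbit \<omega> \<theta> j) + \<kappa>"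
          by linarith
      qed
      then show ?case by (simp add: T_def sum.distrib)
    qed
    then have "(\<integral>\<omega>. T n \<omega> \<theta>' \<partial>B) \<le> (\<integral>\<omega>. T n \<omega> \<theta> + real n * \<kappa> \<partial>B)"
      by (intro integral_mono_AE) (use T_int in auto)
    also have "\<dots> = (\<integral>\<omega>. T n \<omega> \<theta> \<partial>B) + real n * \<kappa>"
      using T_int by (simp add: BP.prob_space)
    finally show ?thesis .
  qed
  have dense: "\<exists>\<theta>\<in>D. dist \<theta>' \<theta> < r" for \<theta>'
  proof (rule ccontr)
    assume "\<not> ?thesis"
    then have "AE \<theta> in torus_haar. \<theta> \<notin> ball \<theta>' r"
      using D by (auto elim: eventually_mono)
    then have "emeasure torus_haar (ball \<theta>' r) = 0"
      by (subst (asm) AE_iff_measurable[of "ball \<theta>' r"]) auto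
    with torus_haar_open_pos[of "ball \<theta>' r"] \<open>0 < r\<close> show False by simp
  qed
  have "(UNIV :: 'd torus set) \<subseteq> (\<Union>\<theta>\<in>D. ball \<theta> r)"
    using dense by (auto simp: dist_commute)
  then obtain F where F: "F \<subseteq> D" "finite F" "(UNIV :: 'd torus set) \<subseteq> (\<Union>\<theta>\<in>F. ball \<theta> r)"
    using compactE_image[OF compact_torus, of D "\<lambda>\<theta>. ball \<theta> r"] by auto
  have "eventually (\<lambda>n. \<forall>\<theta>\<in>F. (\<integral>\<omega>. T n \<omega> \<theta> \<partial>B) \<le> real n * (c + \<kappa>)) sequentially"
    using F good by (intro eventually_ball_finite) auto
  moreover have "eventually (\<lambda>n. 4 * real N * ln L / \<eta> \<le> real n) sequentially"
    using eventually_ge_at_top[of "nat \<lceil>4 * real N * ln L / \<eta>\<rceil>"]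
    by eventually_elim (simp add: nat_ceiling_le_eq)
  ultimately have "eventually (\<lambda>n. (\<forall>\<theta>\<in>F. (\<integral>\<omega>. T n \<omega> \<theta> \<partial>B) \<le> real n * (c + \<kappa>)) \<and>
      4 * real N * ln L / \<eta> \<le> real n \<and> 1 \<le> n) sequentially"
    using eventually_ge_at_top[of 1] by eventually_elim auto
  from eventually_happens'[OF sequentially_bot this] obtain n where n: "\<And>\<theta>. \<theta> \<in> F \<Longrightarrow> (\<integral>\<omega>. T n \<omega> \<theta> \<partial>B) \<le> real n * (c + \<kappa>)"
      "4 * real N * ln L / \<eta> \<le> real n" "1 \<le> n"
    by blast
  show thesis
  proof (rule that[OF n(3)])
    fix \<theta>' :: "'d torus"
    obtain \<theta> where \<theta>: "\<theta> \<in> F" "dist \<theta>' \<theta> < r"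
      using subsetD[OF F(3), of \<theta>'] by (auto simp: dist_commute)
    have "real N * (\<integral>\<omega>. log_norm n \<omega> \<theta>' \<partial>B) = (\<integral>\<omega>. real N * log_norm n \<omega> \<theta>' \<partial>B)" by simp
    also have "\<dots> \<le> (\<integral>\<omega>. T n \<omega> \<theta>' + 2 * real N * real N * ln L \<partial>B)"
    proof (rule integral_mono)
      fix \<omega> assume "\<omega> \<in> space B"
      then show "real N * log_norm n \<omega> \<theta>' \<le> T n \<omega> \<theta>' + 2 * real N * real N * ln L"
        using S.block_average_bound[of "(\<omega>, \<theta>')" N n] T_skew[of n "(\<omega>, \<theta>')"]
        by (simp add: space_pair_measure)
    qed (use integrable_log_norm T_int in auto)
    also have "\<dots> = (\<integral>\<omega>. T n \<omega> \<theta>' \<partial>B) + 2 * real N * real N * ln L"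
      using T_int by (simp add: BP.prob_space)
    also have "\<dots> \<le> real n * (c + \<kappa>) + real n * \<kappa> + 2 * real N * real N * ln L"
      using equi[OF \<theta>(2), of n] n(1)[OF \<theta>(1)] by simp
    also have "\<dots> \<le> real N * (real n * (S.growth + \<eta>))"
    proof -
      have "4 * real N * ln L \<le> real n * \<eta>" using n(2) assms by (simp add: field_simps)
      then have "real N * (4 * real N * ln L) \<le> real N * (real n * \<eta>)" by (rule mult_left_mono) simp
      then show ?thesis by (simp add: c_def \<kappa>_def algebra_simps)
    qed
    finally show "(\<integral>\<omega>. log_norm n \<omega> \<theta>' \<partial>B) \<le> real n * (S.growth + \<eta>)"
      using N(1) by (simp add: mult_le_cancel_left_pos)
  qed
qed

end

section \<open>The Wasserstein distance\<close>

lemma cocycles_le_dist_bounded: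
  obtains D where "0 \<le> D" "\<And>x y :: ('d::finite, 'm::finite) cocycle. x \<in> cocycles_le L \<Longrightarrow> y \<in> cocycles_le L \<Longrightarrow> dist x y \<le> D"
proof -
  obtain T where T: "\<And>a b :: 'd torus. dist a b \<le> T"
    using compact_imp_bounded[OF compact_torus] unfolding bounded_two_points by auto
  show thesis
  proof (rule that[of "max 0 (T + 2 * L)"])
    fix x y :: "('d, 'm) cocycle" assume "x \<in> cocycles_le L" "y \<in> cocycles_le L"
    then have "dist (fibre x) (fibre y) \<le> L + L"
      using norm_triangle_ineq4[of "fibre x" "fibre y"] by (simp add: cocycles_le_def dist_norm)
    then show "dist x y \<le> max 0 (T + 2 * L)"
      using T[of "freq x" "freq y"] by (simp add: dist_cocycle_def)
  qed simp
qed

context cocycle_law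
begin

lemma borel_measurable_lipschitz:
  fixes g :: "('d, 'm) cocycle \<Rightarrow> real"
  assumes "k-lipschitz_on (cocycles_le L) g"
  shows "g \<in> borel_measurable \<nu>"
  by (subst measurable_cong_sets[OF sets_law refl])
    (intro borel_measurable_continuous_on_restrict lipschitz_on_continuous_on[OF assms])

lemma integrable_lipschitz:
  fixes g :: "('d, 'm) cocycle \<Rightarrow> real"
  assumes g: "k-lipschitz_on (cocycles_le L) g"
  shows "integrable \<nu> g"
proof -
  obtain D where D: "0 \<le> D" "\<And>x y :: ('d, 'm) cocycle. x \<in> cocycles_le L \<Longrightarrow> y \<in> cocycles_le L \<Longrightarrow> dist x y \<le> D"
    using cocycles_le_dist_bounded[of L] by blast
  obtain z where z: "z \<in> space \<nu>" using \<nu>.not_empty by blast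
  have "norm (g x) \<le> \<bar>g z\<bar> + k * D" if "x \<in> space \<nu>" for x
  proof -
    have "dist (g x) (g z) \<le> k * dist x z"
      using g that z by (auto simp: lipschitz_on_def space_law)
    also have "\<dots> \<le> k * D"
      using g that z D by (intro mult_left_mono) (auto simp: lipschitz_on_def space_law)
    finally show ?thesis by (simp add: dist_real_def)
  qed
  then show ?thesis
    using borel_measurable_lipschitz[OF g] by (intro \<nu>.integrable_const_bound[of _ "\<bar>g z\<bar> + k * D"]) auto
qed

end

lemma integral_diff_le_W1:
  fixes g :: "('d::finite, 'm::finite) cocycle \<Rightarrow> real"
  assumes "\<nu> \<in> Prob_c (cocycles_le L)" "\<nu>' \<in> Prob_c (cocycles_le L)"
    and "0 < k" and g: "\<And>x y. x \<in> cocycles_le L \<Longrightarrow> y \<in> cocycles_le L \<Longrightarrow> \<bar>g x - g y\<bar> \<le> k * dist x y"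
  shows "integral\<^sup>L \<nu> g - integral\<^sup>L \<nu>' g \<le> k * W1 (cocycles_le L) \<nu> \<nu>'"
proof -
  interpret \<nu>: cocycle_law \<nu> L by unfold_locales fact
  interpret \<nu>': cocycle_law \<nu>' L by unfold_locales fact
  let ?\<Omega> = "cocycles_le L :: ('d, 'm) cocycle set"
  obtain D where D: "0 \<le> D" "\<And>x y. x \<in> ?\<Omega> \<Longrightarrow> y \<in> ?\<Omega> \<Longrightarrow> dist x y \<le> D"
    using cocycles_le_dist_bounded[of L] by blast
  obtain z where z: "z \<in> ?\<Omega>" using \<nu>.\<nu>.not_empty \<nu>.space_law by blast
  have bdd: "bdd_above ((\<lambda>h. integral\<^sup>L \<nu> h - integral\<^sup>L \<nu>' h) ` {h :: ('d, 'm) cocycle \<Rightarrow> real. 1-lipschitz_on ?\<Omega> h})"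
  proof (rule bdd_aboveI2)
    fix h :: "('d, 'm) cocycle \<Rightarrow> real" assume "h \<in> {h. 1-lipschitz_on ?\<Omega> h}"
    then have h: "1-lipschitz_on ?\<Omega> h" by simp
    have near: "\<bar>h x - h z\<bar> \<le> D" if "x \<in> ?\<Omega>" for x
      using lipschitz_onD[OF h that z] D(2)[OF that z] by (simp add: dist_real_def)
    have "integral\<^sup>L \<nu> h \<le> (\<integral>x. h z + D \<partial>\<nu>)"
      by (rule integral_mono) (use near \<nu>.integrable_lipschitz[OF h] in \<open>auto simp: \<nu>.space_law abs_le_iff algebra_simps\<close>)
    moreover have "(\<integral>x. h z - D \<partial>\<nu>') \<le> integral\<^sup>L \<nu>' h"
      by (rule integral_mono) (use near \<nu>'.integrable_lipschitz[OF h] in \<open>auto simp: \<nu>'.space_law abs_le_iff algebra_simps\<close>)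
    ultimately show "integral\<^sup>L \<nu> h - integral\<^sup>L \<nu>' h \<le> 2 * D"
      by (simp add: \<nu>.\<nu>.prob_space \<nu>'.\<nu>.prob_space)
  qed
  have "1-lipschitz_on ?\<Omega> (\<lambda>x. g x / k)"
  proof (rule lipschitz_onI)
    fix x y assume "x \<in> ?\<Omega>" "y \<in> ?\<Omega>"
    then have "\<bar>g x - g y\<bar> / k \<le> dist x y" using g[of x y] \<open>0 < k\<close> by (simp add: field_simps)
    then show "dist (g x / k) (g y / k) \<le> 1 * dist x y"
      using \<open>0 < k\<close> by (simp add: dist_real_def flip: diff_divide_distrib)
  qed simp
  then have "integral\<^sup>L \<nu> (\<lambda>x. g x / k) - integral\<^sup>L \<nu>' (\<lambda>x. g x / k) \<le> W1 ?\<Omega> \<nu> \<nu>'"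
    unfolding W1_def by (intro cSUP_upper bdd) simp
  then show ?thesis using \<open>0 < k\<close> by (simp add: field_simps)
qed

text \<open>Exchange the factors one at a time: with the other coordinates fixed, \<open>H\<close> is a Lipschitz
function of the exchanged coordinate, so each exchange costs at most \<open>k\<close> times the distance.\<close>

lemma integral_PiM_diff_le_W1:
  fixes H :: "('i \<Rightarrow> ('d::finite, 'm::finite) cocycle) \<Rightarrow> real"
  assumes laws: "\<nu> \<in> Prob_c (cocycles_le L)" "\<nu>' \<in> Prob_c (cocycles_le L)"
    and "finite J" "0 < k"
    and H_meas: "H \<in> borel_measurable (PiM J (\<lambda>_. restrict_space borel (cocycles_le L)))"
    and H_bd: "\<And>X. X \<in> J \<rightarrow>\<^sub>E cocycles_le L \<Longrightarrow> \<bar>H X\<bar> \<le> C"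
    and H_lip: "\<And>j X x y. \<lbrakk>j \<in> J; X \<in> (J - {j}) \<rightarrow>\<^sub>E cocycles_le L; x \<in> cocycles_le L; y \<in> cocycles_le L\<rbrakk>
      \<Longrightarrow> \<bar>H (X(j := x)) - H (X(j := y))\<bar> \<le> k * dist x y"
  shows "integral\<^sup>L (PiM J (\<lambda>_. \<nu>)) H - integral\<^sup>L (PiM J (\<lambda>_. \<nu>')) H
    \<le> real (card J) * (k * W1 (cocycles_le L) \<nu> \<nu>')"
proof -
  interpret \<nu>: cocycle_law \<nu> L by unfold_locales fact
  interpret \<nu>': cocycle_law \<nu>' L by unfold_locales fact
  let ?\<Omega> = "cocycles_le L :: ('d, 'm) cocycle set"
  define mix where "mix A i = (if i \<in> A then \<nu> else \<nu>')" for A :: "'i set" and i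
  define Q where "Q A = PiM J (mix A)" for A
  have mix_prob: "prob_space (mix A i)" for A i
    using \<nu>.\<nu>.prob_space_axioms \<nu>'.\<nu>.prob_space_axioms by (simp add: mix_def)
  have mix_sets: "sets (mix A i) = sets (restrict_space borel ?\<Omega>)" for A i
    by (simp add: mix_def \<nu>.sets_law \<nu>'.sets_law)
  have mix_space: "space (mix A i) = ?\<Omega>" for A i
    by (simp add: mix_def \<nu>.space_law \<nu>'.space_law)
  have step: "integral\<^sup>L (Q (insert a A)) H - integral\<^sup>L (Q A) H \<le> k * W1 ?\<Omega> \<nu> \<nu>'"
    if a: "a \<in> J" "a \<notin> A" for a A
  proof -
    define R where "R = PiM (J - {a}) (mix A)"
    interpret R: prob_space R unfolding R_def by (intro prob_space_PiM mix_prob)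
    have R_space: "X \<in> (J - {a}) \<rightarrow>\<^sub>E ?\<Omega>" if "X \<in> space R" for X
      using that by (simp add: R_def space_PiM mix_space)
    have J: "insert a (J - {a}) = J" using a by auto
    have split: "integrable R (\<lambda>X. \<integral>x. H (X(a := x)) \<partial>M) \<and>
        integral\<^sup>L (Q A') H = (\<integral>X. (\<integral>x. H (X(a := x)) \<partial>M) \<partial>R)"
      if A': "mix A' a = M" "\<And>i. i \<noteq> a \<Longrightarrow> mix A' i = mix A i" for A' M
    proof -
      have R_eq: "PiM (J - {a}) (mix A') = R" unfolding R_def by (rule PiM_cong) (use A'(2) in auto)
      have d: "distr (M \<Otimes>\<^sub>M R) (Q A') (\<lambda>(x, X). X(a := x)) = Q A'"
        using distr_pair_PiM_eq_PiM[of "J - {a}" "mix A'" a, OF mix_prob mix_prob] unfolding J A'(1) R_eq Q_def .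
      interpret M: prob_space M using mix_prob[of A' a] A'(1) by simp
      interpret MR: pair_prob_space M R ..
      have m: "(\<lambda>(x, X). X(a := x)) \<in> M \<Otimes>\<^sub>M R \<rightarrow>\<^sub>M Q A'"
      proof -
        have "(\<lambda>p. (snd p)(a := fst p)) \<in> M \<Otimes>\<^sub>M R \<rightarrow>\<^sub>M PiM (insert a (J - {a})) (mix A')"
          by (rule measurable_fun_upd[where J = "J - {a}"]) (use A'(1) R_eq in auto)
        then show ?thesis by (simp only: J Q_def split_beta')
      qed
      have HQ[measurable]: "H \<in> borel_measurable (Q A')"
        unfolding Q_def using H_meas
        by (subst measurable_cong_sets[OF sets_PiM_cong[OF refl mix_sets] refl])
      have "(\<lambda>(x, X). H (X(a := x))) \<in> borel_measurable (M \<Otimes>\<^sub>M R)"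
        using measurable_compose[OF m HQ] by (simp add: split_beta')
      moreover have "\<bar>H (X(a := x))\<bar> \<le> C" if "x \<in> space M" "X \<in> space R" for x X
      proof (rule H_bd)
        have "X(a := x) \<in> insert a (J - {a}) \<rightarrow>\<^sub>E ?\<Omega>"
          using R_space[OF that(2)] that(1) mix_space[of A' a] A'(1) by (intro PiE_fun_upd) auto
        then show "X(a := x) \<in> J \<rightarrow>\<^sub>E ?\<Omega>" by (simp only: J)
      qed
      ultimately have int: "integrable (M \<Otimes>\<^sub>M R) (\<lambda>(x, X). H (X(a := x)))"
        by (intro MR.integrable_const_bound[of _ C]) (auto simp: space_pair_measure)
      have "integral\<^sup>L (Q A') H = integral\<^sup>L (distr (M \<Otimes>\<^sub>M R) (Q A') (\<lambda>(x, X). X(a := x))) H"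
        by (simp only: d)
      also have "\<dots> = (\<integral>p. H ((snd p)(a := fst p)) \<partial>(M \<Otimes>\<^sub>M R))"
        by (subst integral_distr[OF m HQ]) (simp add: split_beta')
      also have "\<dots> = (\<integral>X. (\<integral>x. H (X(a := x)) \<partial>M) \<partial>R)"
        using MR.integral_snd[OF int] by (simp add: split_beta')
      finally show ?thesis
        using MR.integrable_snd[OF int] by simp
    qed
    have s1: "integrable R (\<lambda>X. \<integral>x. H (X(a := x)) \<partial>\<nu>)"
        "integral\<^sup>L (Q (insert a A)) H = (\<integral>X. (\<integral>x. H (X(a := x)) \<partial>\<nu>) \<partial>R)"
      using split[of "insert a A" \<nu>] by (auto simp: mix_def)
    have s2: "integrable R (\<lambda>X. \<integral>x. H (X(a := x)) \<partial>\<nu>')"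
        "integral\<^sup>L (Q A) H = (\<integral>X. (\<integral>x. H (X(a := x)) \<partial>\<nu>') \<partial>R)"
      using split[of A \<nu>'] a by (auto simp: mix_def)
    have "integral\<^sup>L (Q (insert a A)) H - integral\<^sup>L (Q A) H
        = (\<integral>X. (\<integral>x. H (X(a := x)) \<partial>\<nu>) - (\<integral>x. H (X(a := x)) \<partial>\<nu>') \<partial>R)"
      unfolding s1(2) s2(2) using s1(1) s2(1) by simp
    also have "\<dots> \<le> (\<integral>X. k * W1 ?\<Omega> \<nu> \<nu>' \<partial>R)"
    proof (rule integral_mono)
      fix X assume "X \<in> space R"
      then show "(\<integral>x. H (X(a := x)) \<partial>\<nu>) - (\<integral>x. H (X(a := x)) \<partial>\<nu>') \<le> k * W1 ?\<Omega> \<nu> \<nu>'"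
        using H_lip[OF a(1) R_space] by (intro integral_diff_le_W1[OF laws \<open>0 < k\<close>])
    qed (use s1(1) s2(1) in auto)
    also have "\<dots> = k * W1 ?\<Omega> \<nu> \<nu>'" by (simp add: R.prob_space)
    finally show ?thesis .
  qed
  have "integral\<^sup>L (Q A) H - integral\<^sup>L (Q {}) H \<le> real (card A) * (k * W1 ?\<Omega> \<nu> \<nu>')" if "A \<subseteq> J" for A
    using finite_subset[OF that \<open>finite J\<close>] that
  proof (induction A rule: finite_induct)
    case (insert a A)
    then show ?case using step[of a A] by (simp add: algebra_simps)
  qed simp
  from this[of J] show ?thesis
    by (simp add: Q_def mix_def cong: PiM_cong)
qed

section \<open>Semicontinuity\<close>

lemma (in cocycle_law) integral_finite_coordinates:
  fixes H :: "(int \<Rightarrow> ('d, 'm) cocycle) \<Rightarrow> real"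
  assumes "H \<in> borel_measurable (PiM J (\<lambda>_. \<nu>))" "\<And>y. H (restrict y J) = H y"
  shows "(\<integral>y. H y \<partial>B) = (\<integral>y. H y \<partial>PiM J (\<lambda>_. \<nu>))"
proof -
  have m: "(\<lambda>y. restrict y J) \<in> B \<rightarrow>\<^sub>M PiM J (\<lambda>_. \<nu>)"
    unfolding B_eq by (rule measurable_restrict_subset) simp
  have "distr B (PiM J (\<lambda>_. \<nu>)) (\<lambda>y. restrict y J) = PiM J (\<lambda>_. \<nu>)"
    unfolding B_eq using distr_PiM_reindex[of UNIV "\<lambda>_. \<nu>" "\<lambda>i. i" J] \<nu>.prob_space_axioms by simp
  then have "(\<integral>y. H y \<partial>PiM J (\<lambda>_. \<nu>)) = (\<integral>y. H y \<partial>distr B (PiM J (\<lambda>_. \<nu>)) (\<lambda>y. restrict y J))"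
    by simp
  also have "\<dots> = (\<integral>y. H (restrict y J) \<partial>B)" by (rule integral_distr[OF m assms(1)])
  finally show ?thesis by (simp add: assms(2))
qed

text \<open>The majorant is \<open>G \<theta> y = min\<^sub>p (log_norm N p \<theta> + \<eta> + k D y p)\<close>, where \<open>p\<close> ranges over a fine
finite net of words with letters in a compact set that carries \<open>\<nu>0\<close>.  Words \<open>y\<close> within \<open>r\<close> of \<open>p\<close>
satisfy the bound by uniform continuity; for the others \<open>k D y p\<close> already exceeds the largest
possible value of \<open>log_norm N\<close>.  A finite minimum is measurable for the product \<open>\<sigma>\<close>-algebra, and
its Lipschitz constant \<open>k\<close> is the same for all \<open>\<theta>\<close>.\<close>

lemma expected_log_norm_upper_semicontinuous:
  fixes \<nu>0 :: "('d::finite, 'm::finite) cocycle measure"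
  assumes law0: "\<nu>0 \<in> Prob_c (cocycles_le L)" and "0 < \<epsilon>"
  shows "\<exists>\<delta>>0. \<forall>\<nu>\<in>Prob_c (cocycles_le L). W1 (cocycles_le L) \<nu> \<nu>0 < \<delta> \<longrightarrow>
    (\<forall>\<theta>. (\<integral>\<omega>. log_norm N \<omega> \<theta> \<partial>bernoulli_measure \<nu>) \<le> (\<integral>\<omega>. log_norm N \<omega> \<theta> \<partial>bernoulli_measure \<nu>0) + \<epsilon>)"
proof -
  let ?\<Omega> = "cocycles_le L :: ('d, 'm) cocycle set"
  interpret \<nu>0: cocycle_law \<nu>0 L by unfold_locales fact
  define \<eta> where "\<eta> = \<epsilon> / 4"
  have "0 < \<eta>" using \<open>0 < \<epsilon>\<close> by (simp add: \<eta>_def)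
  obtain K where K: "compact K" "K \<subseteq> ?\<Omega>" and K_AE: "AE x in \<nu>0. x \<in> K" "AE \<omega> in \<nu>0.B. \<forall>i. \<omega> i \<in> K"
    by (rule \<nu>0.compact_support)
  have "K \<noteq> {}" using K_AE(1) by auto
  from log_norm_uniformly_continuous_near_compact[OF K \<nu>0.L_ge_1 \<open>0 < \<eta>\<close>, of N]
  obtain r where r: "0 < r" "\<forall>p y \<theta> \<theta>'. (\<forall>i<N. p (int i) \<in> K \<and> y (int i) \<in> ?\<Omega> \<and> dist (y (int i)) (p (int i)) < r)
    \<longrightarrow> dist \<theta>' \<theta> < r \<longrightarrow> \<bar>log_norm N y \<theta>' - log_norm N p \<theta>\<bar> < \<eta>"
    by blast
  have lnL: "0 \<le> ln L" using \<nu>0.L_ge_1 by simp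
  define C where "C = real N * ln L"
  \<comment> \<open>Large enough for \<open>k r \<ge> C\<close>, and positive also if \<open>C = 0\<close>.\<close>
  define k where "k = (C + 1) / r"
  have "0 \<le> C" using lnL by (simp add: C_def)
  have k: "0 < k" "C \<le> k * r" using r(1) \<open>0 \<le> C\<close> by (simp_all add: k_def)
  \<comment> \<open>The scale of the net: its contribution \<open>k N \<rho>\<close> to the majorant is at most \<open>\<eta>\<close>.\<close>
  define \<rho> where "\<rho> = min r (\<eta> / (k * real (N + 1)))"
  have "0 < \<rho>" using r(1) \<open>0 < \<eta>\<close> k by (simp add: \<rho>_def)
  have \<rho>: "k * (real N * \<rho>) \<le> \<eta>"
  proof -
    have "k * (real N * \<rho>) \<le> (k * real (N + 1)) * \<rho>" using k \<open>0 < \<rho>\<close> by (simp add: algebra_simps)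
    also have "\<dots> \<le> (k * real (N + 1)) * (\<eta> / (k * real (N + 1)))"
      using k by (intro mult_left_mono) (simp_all add: \<rho>_def)
    also have "\<dots> = \<eta>" using k by simp
    finally show ?thesis .
  qed
  have "K \<subseteq> (\<Union>x\<in>K. ball x \<rho>)" using \<open>0 < \<rho>\<close> by auto
  then obtain F0 where F0: "F0 \<subseteq> K" "finite F0" "K \<subseteq> (\<Union>x\<in>F0. ball x \<rho>)"
    using compactE_image[OF K(1), of K "\<lambda>x. ball x \<rho>"] by auto
  have "F0 \<noteq> {}" using F0 \<open>K \<noteq> {}\<close> by auto
  define J where "J = int ` {..<N}"
  have J: "finite J" "card J = N" by (auto simp: J_def card_image)
  define F where "F = (J \<rightarrow>\<^sub>E F0)"
  have F: "finite F" "F \<noteq> {}" using F0 J \<open>F0 \<noteq> {}\<close> by (auto simp: F_def finite_PiE PiE_eq_empty_iff)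
  have F_in: "p (int i) \<in> K" if "p \<in> F" "i < N" for p i
    using that F0 by (auto simp: F_def J_def PiE_def)
  define D where "D y p = (\<Sum>i<N. dist (y (int i)) (p (int i)))" for y p :: "int \<Rightarrow> ('d, 'm) cocycle"
  have D_nonneg: "0 \<le> D y p" for y p unfolding D_def by (intro sum_nonneg) simp
  define G where "G \<theta> y = Min ((\<lambda>p. log_norm N p \<theta> + \<eta> + k * D y p) ` F)" for \<theta> y
  have G_le: "G \<theta> y \<le> log_norm N p \<theta> + \<eta> + k * D y p" if "p \<in> F" for \<theta> y p
    unfolding G_def using F that by (intro Min_le) auto
  have G_ge: "c \<le> G \<theta> y" if "\<And>p. p \<in> F \<Longrightarrow> c \<le> log_norm N p \<theta> + \<eta> + k * D y p" for \<theta> y c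
    unfolding G_def using F that by (subst Min_ge_iff) auto
  have major: "log_norm N y \<theta> \<le> G \<theta> y" if y: "\<And>i. y i \<in> ?\<Omega>" for y \<theta>
  proof (rule G_ge)
    fix p assume p: "p \<in> F"
    show "log_norm N y \<theta> \<le> log_norm N p \<theta> + \<eta> + k * D y p"
    proof (cases "\<forall>i<N. dist (y (int i)) (p (int i)) < r")
      case True
      then have "\<bar>log_norm N y \<theta> - log_norm N p \<theta>\<bar> < \<eta>"
        using y F_in[OF p] r(1) by (intro r(2)[rule_format]) auto
      moreover have "0 \<le> k * D y p" using k D_nonneg by simp
      ultimately show ?thesis by linarith
    next
      case False
      then obtain i where i: "i < N" "r \<le> dist (y (int i)) (p (int i))" by (auto simp: not_less)
      have "dist (y (int i)) (p (int i)) \<le> D y p"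
        unfolding D_def using i by (intro member_le_sum) auto
      then have "k * r \<le> k * D y p" using i k by (intro mult_left_mono) auto
      moreover have "log_norm N y \<theta> \<le> C"
        unfolding C_def using y \<nu>0.L_ge_1 by (intro log_norm_le) auto
      ultimately show ?thesis using k \<open>0 < \<eta>\<close> log_norm_nonneg[of N p \<theta>] by linarith
    qed
  qed
  have tight: "G \<theta> y \<le> log_norm N y \<theta> + 3 * \<eta>" if y: "\<And>i. y i \<in> K" for y \<theta>
  proof -
    have "\<forall>i. \<exists>x\<in>F0. dist x (y i) < \<rho>" using F0(3) y by fastforce
    then obtain q where q: "\<And>i. q i \<in> F0" "\<And>i. dist (q i) (y i) < \<rho>" by metis
    define p where "p = restrict q J"
    have p: "p \<in> F" using q(1) by (auto simp: p_def F_def)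
    have close: "dist (y (int i)) (p (int i)) < \<rho>" if "i < N" for i
      using q(2)[of "int i"] that by (simp add: p_def J_def dist_commute)
    have "\<bar>log_norm N y \<theta> - log_norm N p \<theta>\<bar> < \<eta>"
      using y F_in[OF p] r(1) close K(2) by (intro r(2)[rule_format]) (auto simp: \<rho>_def)
    moreover have "D y p \<le> real N * \<rho>"
      using sum_mono[of "{..<N}" "\<lambda>i. dist (y (int i)) (p (int i))" "\<lambda>_. \<rho>"] close
      by (simp add: D_def less_imp_le)
    then have "k * D y p \<le> k * (real N * \<rho>)" using k by (intro mult_left_mono) auto
    ultimately show ?thesis using G_le[OF p, of \<theta> y] \<rho> by linarith
  qed
  obtain Dm where Dm: "0 \<le> Dm" "\<And>x y. x \<in> ?\<Omega> \<Longrightarrow> y \<in> ?\<Omega> \<Longrightarrow> dist x y \<le> Dm"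
    using cocycles_le_dist_bounded[of L] by blast
  have G_nonneg: "0 \<le> G \<theta> y" for \<theta> y
    using k \<open>0 < \<eta>\<close> by (intro G_ge add_nonneg_nonneg mult_nonneg_nonneg log_norm_nonneg D_nonneg) auto
  have G_bd: "\<bar>G \<theta> y\<bar> \<le> C + \<eta> + k * (real N * Dm)" if y: "\<And>i. i \<in> J \<Longrightarrow> y i \<in> ?\<Omega>" for \<theta> y
  proof -
    obtain p where p: "p \<in> F" using F by blast
    have "dist (y (int i)) (p (int i)) \<le> Dm" if "i < N" for i
      using y[of "int i"] F_in[OF p that] K(2) that by (intro Dm(2)) (auto simp: J_def)
    then have "D y p \<le> real N * Dm"
      using sum_mono[of "{..<N}" "\<lambda>i. dist (y (int i)) (p (int i))" "\<lambda>_. Dm"] by (simp add: D_def)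
    then have "k * D y p \<le> k * (real N * Dm)" using k by (intro mult_left_mono) auto
    moreover have "log_norm N p \<theta> \<le> C"
      unfolding C_def using F_in[OF p] K(2) \<nu>0.L_ge_1 by (intro log_norm_le) auto
    ultimately show ?thesis using G_le[OF p, of \<theta> y] G_nonneg[of \<theta> y] by linarith
  qed
  have G_restrict: "G \<theta> (restrict y J) = G \<theta> y" for \<theta> y
    by (simp add: G_def D_def J_def)
  have G_lip: "\<bar>G \<theta> (X(j := x)) - G \<theta> (X(j := y))\<bar> \<le> k * dist x y" for \<theta> X j x y
  proof -
    have "G \<theta> (X(j := x)) - k * dist x y \<le> G \<theta> (X(j := y))" for x y
    proof (rule G_ge)
      fix p assume p: "p \<in> F"
      have "D (X(j := x)) p \<le> D (X(j := y)) p + dist x y"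
      proof (cases "j \<in> J")
        case True
        then obtain l where l: "l < N" "j = int l" by (auto simp: J_def)
        have split: "D (X(j := z)) p = dist z (p j) + (\<Sum>i\<in>{..<N} - {l}. dist (X (int i)) (p (int i)))" for z
          unfolding D_def using l by (subst sum.remove[of _ l]) auto
        show ?thesis unfolding split using dist_triangle[of x "p j" y] by simp
      next
        case False
        then have "D (X(j := z)) p = D X p" for z by (auto simp: D_def J_def intro!: sum.cong)
        then show ?thesis by simp
      qed
      then have "k * D (X(j := x)) p \<le> k * (D (X(j := y)) p + dist x y)" using k by (intro mult_left_mono) auto
      then show "G \<theta> (X(j := x)) - k * dist x y \<le> log_norm N p \<theta> + \<eta> + k * D (X(j := y)) p"
        using G_le[OF p, of \<theta> "X(j := x)"] by (simp add: algebra_simps)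
    qed
    from this[of x y] this[of y x] show ?thesis by (simp add: abs_le_iff dist_commute)
  qed
  have G_meas: "G \<theta> \<in> borel_measurable M" if "\<And>i. i \<in> J \<Longrightarrow> (\<lambda>y. y i) \<in> borel_measurable M" for \<theta> M
  proof -
    have "(\<lambda>y. dist (y (int i)) (p (int i))) \<in> borel_measurable M" if "i < N" for i p
    proof -
      have "(\<lambda>x. dist x (p (int i))) \<in> borel_measurable borel"
        by (intro borel_measurable_continuous_onI continuous_intros)
      moreover have "(\<lambda>y. y (int i)) \<in> borel_measurable M"
        using that \<open>\<And>i. i \<in> J \<Longrightarrow> (\<lambda>y. y i) \<in> borel_measurable M\<close> by (simp add: J_def)
      ultimately show ?thesis using measurable_compose by blast
    qed
    then show ?thesis
      unfolding G_def D_def using F(1) by (intro borel_measurable_Min borel_measurable_add borel_measurable_times borel_measurable_sum borel_measurable_const) auto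
  qed
  have id_meas: "(\<lambda>x. x) \<in> restrict_space borel ?\<Omega> \<rightarrow>\<^sub>M borel" by (intro measurable_restrict_space1) simp
  define \<delta> where "\<delta> = \<eta> / (real N * k + 1)"
  have pos: "0 < real N * k + 1" using k by (simp add: add_nonneg_pos)
  show ?thesis
  proof (intro exI[of _ \<delta>] conjI ballI impI allI)
    show "0 < \<delta>" using \<open>0 < \<eta>\<close> pos by (simp add: \<delta>_def)
    fix \<nu> :: "('d, 'm) cocycle measure" and \<theta> :: "'d torus"
    assume law: "\<nu> \<in> Prob_c ?\<Omega>" and W: "W1 ?\<Omega> \<nu> \<nu>0 < \<delta>"
    interpret \<nu>: cocycle_law \<nu> L by unfold_locales fact
    have coord: "(\<lambda>y. y i) \<in> borel_measurable (PiM J (\<lambda>_. M))" if "i \<in> J" "(\<lambda>x. x) \<in> M \<rightarrow>\<^sub>M borel" for i and M :: "('d, 'm) cocycle measure"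
      using measurable_compose[OF measurable_component_singleton[OF that(1)] that(2)] by simp
    have int: "integrable \<nu>.B (G \<theta>)" "integrable \<nu>0.B (G \<theta>)"
      by (rule \<nu>.BP.integrable_const_bound[of _ "C + \<eta> + k * (real N * Dm)"],
          use G_bd \<nu>.B_space in \<open>auto intro!: AE_I2\<close>, intro G_meas \<nu>.B_coordinate)
        (rule \<nu>0.BP.integrable_const_bound[of _ "C + \<eta> + k * (real N * Dm)"],
          use G_bd \<nu>0.B_space in \<open>auto intro!: AE_I2\<close>, intro G_meas \<nu>0.B_coordinate)
    have "(\<integral>\<omega>. log_norm N \<omega> \<theta> \<partial>\<nu>.B) \<le> (\<integral>\<omega>. G \<theta> \<omega> \<partial>\<nu>.B)"
      by (rule integral_mono) (use \<nu>.integrable_log_norm int major \<nu>.B_space in auto)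
    also have "\<dots> = (\<integral>\<omega>. G \<theta> \<omega> \<partial>PiM J (\<lambda>_. \<nu>))"
      by (intro \<nu>.integral_finite_coordinates G_meas coord \<nu>.id_measurable G_restrict)
    also have "\<dots> \<le> (\<integral>\<omega>. G \<theta> \<omega> \<partial>PiM J (\<lambda>_. \<nu>0)) + real (card J) * (k * W1 ?\<Omega> \<nu> \<nu>0)"
      using integral_PiM_diff_le_W1[OF law law0 J(1) k(1), of "G \<theta>" "C + \<eta> + k * (real N * Dm)"]
        G_bd G_lip G_meas[OF coord[OF _ id_meas]] by (force simp: PiE_iff)
    also have "(\<integral>\<omega>. G \<theta> \<omega> \<partial>PiM J (\<lambda>_. \<nu>0)) = (\<integral>\<omega>. G \<theta> \<omega> \<partial>\<nu>0.B)"
      by (intro \<nu>0.integral_finite_coordinates[symmetric] G_meas coord \<nu>0.id_measurable G_restrict)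
    also have "\<dots> \<le> (\<integral>\<omega>. log_norm N \<omega> \<theta> + 3 * \<eta> \<partial>\<nu>0.B)"
      by (rule integral_mono_AE) (use \<nu>0.integrable_log_norm int K_AE(2) tight in \<open>auto elim: eventually_mono\<close>)
    also have "\<dots> = (\<integral>\<omega>. log_norm N \<omega> \<theta> \<partial>\<nu>0.B) + 3 * \<eta>"
      using \<nu>0.integrable_log_norm by (simp add: \<nu>0.BP.prob_space)
    also have "real (card J) * (k * W1 ?\<Omega> \<nu> \<nu>0) \<le> \<eta>"
    proof -
      have "real (card J) * (k * W1 ?\<Omega> \<nu> \<nu>0) \<le> (real N * k) * \<delta>"
        unfolding J(2) mult.assoc[symmetric] using W k by (intro mult_left_mono) auto
      also have "\<dots> \<le> (real N * k + 1) * \<delta>" using \<open>0 < \<delta>\<close> by (intro mult_right_mono) auto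
      also have "\<dots> = \<eta>" using pos by (simp add: \<delta>_def)
      finally show ?thesis .
    qed
    finally show "(\<integral>\<omega>. log_norm N \<omega> \<theta> \<partial>\<nu>.B) \<le> (\<integral>\<omega>. log_norm N \<omega> \<theta> \<partial>\<nu>0.B) + \<epsilon>"
      by (simp add: \<eta>_def)
  qed
qed

section \<open>Exponential moments\<close>

definition splice_at :: "nat \<Rightarrow> (int \<Rightarrow> 'a) \<Rightarrow> (int \<Rightarrow> 'a) \<Rightarrow> int \<Rightarrow> 'a" where
  "splice_at n \<omega> \<omega>' i = (if i < int n then \<omega> i else \<omega>' (i - int n))"

lemma log_norm_splice_at:
  "log_norm (m + n) (splice_at m \<omega> \<omega>') \<theta> \<le> log_norm m \<omega> \<theta> + log_norm n \<omega>' (orbit \<omega> \<theta> m)"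
proof -
  have "iterate m (splice_at m \<omega> \<omega>') \<theta> = iterate m \<omega> \<theta>" "orbit (splice_at m \<omega> \<omega>') \<theta> m = orbit \<omega> \<theta> m"
    by (rule iterate_cong orbit_cong, simp add: splice_at_def)+
  moreover have "iterate n (\<lambda>i. splice_at m \<omega> \<omega>' (i + int m)) t = iterate n \<omega>' t" for t
    by (rule iterate_cong) (simp add: splice_at_def)
  ultimately show ?thesis
    using log_norm_add[of m n "splice_at m \<omega> \<omega>'" \<theta>] by (simp add: log_norm_def)
qed

context cocycle_law
begin

sublocale BB: pair_prob_space B B ..

lemma measurable_splice_at: "(\<lambda>(\<omega>, \<omega>'). splice_at n \<omega> \<omega>') \<in> B \<Otimes>\<^sub>M B \<rightarrow>\<^sub>M B"
proof -
  have "(\<lambda>p. splice_at n (fst p) (snd p)) \<in> B \<Otimes>\<^sub>M B \<rightarrow>\<^sub>M PiM UNIV (\<lambda>_. \<nu>)"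
  proof (rule measurable_PiM_single')
    fix i
    have "(\<lambda>p. fst p i) \<in> B \<Otimes>\<^sub>M B \<rightarrow>\<^sub>M \<nu>" "(\<lambda>p. snd p (i - int n)) \<in> B \<Otimes>\<^sub>M B \<rightarrow>\<^sub>M \<nu>"
      using measurable_compose[OF measurable_fst B_coordinate_law] measurable_compose[OF measurable_snd B_coordinate_law] by auto
    then show "(\<lambda>p. splice_at n (fst p) (snd p) i) \<in> B \<Otimes>\<^sub>M B \<rightarrow>\<^sub>M \<nu>"
      by (cases "i < int n") (simp_all add: splice_at_def)
  next
    show "(\<lambda>p. splice_at n (fst p) (snd p)) \<in> space (B \<Otimes>\<^sub>M B) \<rightarrow> UNIV \<rightarrow>\<^sub>E space \<nu>"
      using B_space by (auto simp: space_pair_measure splice_at_def space_law)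
  qed
  then show ?thesis by (simp add: split_beta' B_eq)
qed

text \<open>Letters at times below \<open>n\<close> and from \<open>n\<close> on are independent, and the future is distributed
like the whole word.\<close>

lemma distr_splice_at: "distr (B \<Otimes>\<^sub>M B) B (\<lambda>(\<omega>, \<omega>'). splice_at n \<omega> \<omega>') = B"
proof -
  let ?f = "\<lambda>(\<omega>, \<omega>'). splice_at n \<omega> \<omega>'"
  let ?emb = "prod_emb (UNIV :: int set) (\<lambda>_. \<nu>)"
  have "distr (B \<Otimes>\<^sub>M B) B ?f = PiM UNIV (\<lambda>_. \<nu>)"
  proof (rule B.PiM_eq)
    fix J and E :: "int \<Rightarrow> ('d, 'm) cocycle set"
    assume J: "finite J" "J \<subseteq> UNIV" "\<And>j. j \<in> J \<Longrightarrow> E j \<in> sets \<nu>"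
    let ?X = "?emb J (\<Pi>\<^sub>E j\<in>J. E j)"
    define J1 where "J1 = J \<inter> {..<int n}"
    define J2 where "J2 = (\<lambda>j. j - int n) ` (J - {..<int n})"
    have fin: "finite J1" "finite J2" using J(1) by (auto simp: J1_def J2_def)
    have E1: "E j \<in> sets \<nu>" if "j \<in> J1" for j using J that by (auto simp: J1_def)
    have E2: "E (j + int n) \<in> sets \<nu>" if "j \<in> J2" for j using J that by (auto simp: J2_def)
    let ?E = "?emb J1 (\<Pi>\<^sub>E j\<in>J1. E j)" and ?F = "?emb J2 (\<Pi>\<^sub>E j\<in>J2. E (j + int n))"
    have X: "?X \<in> sets B" unfolding B_eq using J by (intro sets_PiM_I) auto
    have EF: "?E \<in> sets B" "?F \<in> sets B"
      unfolding B_eq using fin E1 E2 by (auto intro!: sets_PiM_I)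
    have "splice_at n \<omega> \<omega>' \<in> ?X \<longleftrightarrow> \<omega> \<in> ?E \<and> \<omega>' \<in> ?F" if "\<omega> \<in> space B" "\<omega>' \<in> space B" for \<omega> \<omega>'
    proof -
      have w: "\<omega> i \<in> space \<nu>" "\<omega>' i \<in> space \<nu>" for i
        using B_space that by (auto simp: space_law)
      have "splice_at n \<omega> \<omega>' \<in> ?X \<longleftrightarrow> (\<forall>j\<in>J. splice_at n \<omega> \<omega>' j \<in> E j)"
        using w by (auto simp: prod_emb_iff Pi_iff splice_at_def)
      also have "\<dots> \<longleftrightarrow> (\<forall>j\<in>J1. \<omega> j \<in> E j) \<and> (\<forall>j\<in>J2. \<omega>' j \<in> E (j + int n))"
        by (auto simp: J1_def J2_def splice_at_def)
      also have "\<dots> \<longleftrightarrow> \<omega> \<in> ?E \<and> \<omega>' \<in> ?F"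
        using w by (auto simp: prod_emb_iff)
      finally show ?thesis .
    qed
    moreover have "?E \<subseteq> space B" "?F \<subseteq> space B" using EF sets.sets_into_space by blast+
    ultimately have pre: "?f -` ?X \<inter> space (B \<Otimes>\<^sub>M B) = ?E \<times> ?F"
      by (auto simp: space_pair_measure subset_eq)
    have "emeasure (distr (B \<Otimes>\<^sub>M B) B ?f) ?X = emeasure B ?E * emeasure B ?F"
      using EF by (simp add: emeasure_distr[OF measurable_splice_at X] pre BP.emeasure_pair_measure_Times)
    also have "emeasure B ?E = (\<Prod>j\<in>J1. emeasure \<nu> (E j))"
      unfolding B_eq by (intro B.emeasure_PiM_emb fin E1) auto
    also have "emeasure B ?F = (\<Prod>j\<in>J2. emeasure \<nu> (E (j + int n)))"
      unfolding B_eq by (intro B.emeasure_PiM_emb fin E2) auto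
    also have "\<dots> = (\<Prod>j\<in>J - {..<int n}. emeasure \<nu> (E j))"
      unfolding J2_def by (subst prod.reindex) (auto simp: inj_on_def)
    also have "(\<Prod>j\<in>J1. emeasure \<nu> (E j)) * \<dots> = (\<Prod>j\<in>J. emeasure \<nu> (E j))"
      unfolding J1_def using J(1) prod.Int_Diff by metis
    finally show "emeasure (distr (B \<Otimes>\<^sub>M B) B ?f) ?X = (\<Prod>j\<in>J. emeasure \<nu> (E j))" .
  qed (simp add: B_eq)
  then show ?thesis by (simp add: B_eq)
qed

lemma integrable_exp_log_norm:
  assumes "0 \<le> t"
  shows "integrable B (\<lambda>\<omega>. exp (t * log_norm n \<omega> \<theta>))"
  by (rule BP.integrable_const_bound[of _ "exp (t * (real n * ln L))"])
    (use assms log_norm_le_of_law in \<open>auto intro!: AE_I2 mult_left_mono\<close>)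

text \<open>Conditionally on the first block, the remaining blocks form a fresh word that starts at
another point of the torus; as the bound \<open>a\<close> does not depend on the starting point, the
conditional moment is at most \<open>a ^ q\<close>.\<close>

lemma exp_moment_power:
  assumes "0 \<le> t" and a: "\<And>\<theta>. (\<integral>\<omega>. exp (t * log_norm N \<omega> \<theta>) \<partial>B) \<le> a"
  shows "(\<integral>\<omega>. exp (t * log_norm (q * N) \<omega> \<theta>) \<partial>B) \<le> a ^ q"
proof (induction q arbitrary: \<theta>)
  case 0
  then show ?case by (simp add: log_norm_def BP.prob_space norm_blinfun_id)
next
  case (Suc q)
  have "0 \<le> (\<integral>\<omega>. exp (t * log_norm N \<omega> \<theta>) \<partial>B)" for \<theta> by (rule integral_nonneg_AE) simp
  then have "0 \<le> a" using a order_trans by blast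
  let ?g = "\<lambda>\<omega> \<omega>'. exp (t * log_norm N \<omega> \<theta>) * exp (t * log_norm (q * N) \<omega>' (orbit \<omega> \<theta> N))"
  have meas[measurable]: "(\<lambda>p. log_norm N (fst p) \<theta>) \<in> borel_measurable (B \<Otimes>\<^sub>M B)"
    "(\<lambda>p. log_norm (q * N) (snd p) (orbit (fst p) \<theta> N)) \<in> borel_measurable (B \<Otimes>\<^sub>M B)"
    by (intro borel_measurable_iterate borel_measurable_orbit; measurable)+
  have le: "log_norm n \<omega> z \<le> real n * ln L" if "\<omega> \<in> space B" for n \<omega> z
    using that by (rule log_norm_le_of_law)
  have int_g: "integrable (B \<Otimes>\<^sub>M B) (case_prod ?g)"
    by (rule BB.integrable_const_bound[of _ "exp (t * (real N * ln L)) * exp (t * (real (q * N) * ln L))"])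
      (use le assms(1) in \<open>auto intro!: AE_I2 mult_mono mult_left_mono simp: space_pair_measure split_beta' simp del: of_nat_mult\<close>)
  have m: "(\<lambda>\<omega>. exp (t * log_norm (Suc q * N) \<omega> \<theta>)) \<in> borel_measurable B" by measurable
  have "(\<integral>\<omega>. exp (t * log_norm (Suc q * N) \<omega> \<theta>) \<partial>B)
      = (\<integral>\<omega>. exp (t * log_norm (Suc q * N) \<omega> \<theta>) \<partial>distr (B \<Otimes>\<^sub>M B) B (\<lambda>(\<omega>, \<omega>'). splice_at N \<omega> \<omega>'))"
    by (simp only: distr_splice_at)
  also have "\<dots> = (\<integral>p. exp (t * log_norm (Suc q * N) (splice_at N (fst p) (snd p)) \<theta>) \<partial>(B \<Otimes>\<^sub>M B))"
    by (subst integral_distr[OF measurable_splice_at m]) (simp add: split_beta')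
  also have "\<dots> \<le> (\<integral>p. case_prod ?g p \<partial>(B \<Otimes>\<^sub>M B))"
  proof (rule integral_mono)
    show "integrable (B \<Otimes>\<^sub>M B) (\<lambda>p. exp (t * log_norm (Suc q * N) (splice_at N (fst p) (snd p)) \<theta>))"
    proof -
      have "integrable (distr (B \<Otimes>\<^sub>M B) B (\<lambda>(\<omega>, \<omega>'). splice_at N \<omega> \<omega>')) (\<lambda>\<omega>. exp (t * log_norm (Suc q * N) \<omega> \<theta>))"
        unfolding distr_splice_at by (rule integrable_exp_log_norm[OF assms(1)])
      from integrable_distr[OF measurable_splice_at this] show ?thesis by (simp add: split_beta')
    qed
    show "exp (t * log_norm (Suc q * N) (splice_at N (fst p) (snd p)) \<theta>) \<le> case_prod ?g p" for p
      using mult_left_mono[OF log_norm_splice_at[of N "q * N" "fst p" "snd p" \<theta>] assms(1)]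
      by (simp add: split_beta' distrib_left flip: exp_add)
  qed (rule int_g)
  also have "\<dots> = (\<integral>\<omega>. (\<integral>\<omega>'. ?g \<omega> \<omega>' \<partial>B) \<partial>B)"
    using BB.integral_fst'[OF int_g] by simp
  also have "\<dots> \<le> (\<integral>\<omega>. exp (t * log_norm N \<omega> \<theta>) * a ^ q \<partial>B)"
  proof (rule integral_mono)
    show "integrable B (\<lambda>\<omega>. \<integral>\<omega>'. ?g \<omega> \<omega>' \<partial>B)" using BB.integrable_fst'[OF int_g] by simp
    show "integrable B (\<lambda>\<omega>. exp (t * log_norm N \<omega> \<theta>) * a ^ q)" using integrable_exp_log_norm[OF assms(1)] by simp
    show "(\<integral>\<omega>'. ?g \<omega> \<omega>' \<partial>B) \<le> exp (t * log_norm N \<omega> \<theta>) * a ^ q" for \<omega>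
      using Suc[of "orbit \<omega> \<theta> N"] by simp
  qed
  also have "\<dots> \<le> a * a ^ q"
    using a[of \<theta>] \<open>0 \<le> a\<close> by (simp add: mult_right_mono)
  finally show ?case by simp
qed

lemma exp_moment_le:
  assumes "0 \<le> t" "t * (real N * c) \<le> 1" "ln L \<le> c" and b: "\<And>\<theta>. (\<integral>\<omega>. log_norm N \<omega> \<theta> \<partial>B) \<le> real N * b"
  shows "(\<integral>\<omega>. exp (t * log_norm N \<omega> \<theta>) \<partial>B) \<le> exp (t * (real N * b) + (t * (real N * c))\<^sup>2)"
proof -
  let ?s = "(t * (real N * c))\<^sup>2"
  have "(\<integral>\<omega>. exp (t * log_norm N \<omega> \<theta>) \<partial>B) \<le> (\<integral>\<omega>. 1 + t * log_norm N \<omega> \<theta> + ?s \<partial>B)"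
  proof (rule integral_mono)
    fix \<omega> assume \<omega>: "\<omega> \<in> space B"
    let ?x = "t * log_norm N \<omega> \<theta>"
    have x: "0 \<le> ?x" "?x \<le> t * (real N * c)"
    proof -
      have "log_norm N \<omega> \<theta> \<le> real N * ln L" by (rule log_norm_le_of_law[OF \<omega>])
      also have "\<dots> \<le> real N * c" using assms(3) by (intro mult_left_mono) auto
      finally show "?x \<le> t * (real N * c)" using assms(1) by (intro mult_left_mono)
    qed (intro mult_nonneg_nonneg assms(1) log_norm_nonneg)
    have "exp ?x \<le> 1 + ?x + ?x\<^sup>2" by (rule exp_bound) (use x assms in auto)
    also have "?x\<^sup>2 \<le> ?s" using x by (intro power_mono) auto
    finally show "exp ?x \<le> 1 + ?x + ?s" by simp
  qed (use integrable_exp_log_norm[OF assms(1)] integrable_log_norm in auto)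
  also have "\<dots> = 1 + t * (\<integral>\<omega>. log_norm N \<omega> \<theta> \<partial>B) + ?s"
    using integrable_log_norm by (simp add: BP.prob_space)
  also have "\<dots> \<le> 1 + (t * (real N * b) + ?s)" using mult_left_mono[OF b assms(1)] by simp
  also have "\<dots> \<le> exp (t * (real N * b) + ?s)" by (rule exp_ge_add_one_self)
  finally show ?thesis .
qed

text \<open>Chernoff's bound for the \<open>n div N\<close> complete blocks; the incomplete block increases the
logarithm of the norm by at most \<open>N c\<close>.  The parameter \<open>t\<close> is so small that the second order term
of the exponential moment uses up only half of the gain \<open>t n \<eta>\<close>.\<close>

lemma large_deviation_bound:
  assumes "1 \<le> N" "0 < t" "t * (real N * c) \<le> 1" "ln L \<le> c" "t * (real N * c\<^sup>2) \<le> \<eta> / 2"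
    and b: "\<And>\<theta>. (\<integral>\<omega>. log_norm N \<omega> \<theta> \<partial>B) \<le> real N * b"
  shows "measure B {\<omega> \<in> space B. log_norm n \<omega> \<theta> \<ge> real n * (b + \<eta>)} \<le> exp (t * (real N * c) - t * (real n * \<eta>) / 2)"
proof -
  define q where "q = n div N"
  define r where "r = n mod N"
  have n: "n = q * N + r" "r \<le> N" using assms(1) by (auto simp: q_def r_def less_imp_le)
  have c: "0 \<le> c" using assms(4) L_ge_1 by (smt (verit) ln_ge_zero)
  have "0 \<le> (\<integral>\<omega>. log_norm N \<omega> \<theta> \<partial>B)" by (rule integral_nonneg_AE) (simp add: log_norm_nonneg)
  then have "0 \<le> real N * b" using b[of \<theta>] by linarith
  then have "0 \<le> b" using assms(1) by (simp add: zero_le_mult_iff)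
  have "0 \<le> t * (real N * c\<^sup>2)" using assms(2) by simp
  then have \<eta>: "0 \<le> \<eta>" using assms(5) by linarith
  define a where "a = exp (t * (real N * b) + (t * (real N * c))\<^sup>2)"
  define s where "s = real n * (b + \<eta>) - real N * c"
  have "measure B {\<omega> \<in> space B. log_norm n \<omega> \<theta> \<ge> real n * (b + \<eta>)}
      \<le> measure B {\<omega> \<in> space B. exp (t * log_norm (q * N) \<omega> \<theta>) \<ge> exp (t * s)}"
  proof (rule BP.finite_measure_mono)
    show "{\<omega> \<in> space B. log_norm n \<omega> \<theta> \<ge> real n * (b + \<eta>)} \<subseteq> {\<omega> \<in> space B. exp (t * log_norm (q * N) \<omega> \<theta>) \<ge> exp (t * s)}"
    proof (intro subsetI)
      fix \<omega> assume "\<omega> \<in> {\<omega> \<in> space B. log_norm n \<omega> \<theta> \<ge> real n * (b + \<eta>)}"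
      then have \<omega>: "\<omega> \<in> space B" "real n * (b + \<eta>) \<le> log_norm n \<omega> \<theta>" by auto
      have "log_norm n \<omega> \<theta> \<le> log_norm (q * N) \<omega> \<theta> + real r * ln L"
        using log_norm_add[of "q * N" r \<omega> \<theta>] shifted_log_norm_le[OF \<omega>(1), of r "int (q * N)" "orbit \<omega> \<theta> (q * N)"]
        by (simp add: n(1)[symmetric])
      also have "real r * ln L \<le> real N * c" using n(2) assms(4) c L_ge_1 by (intro mult_mono) auto
      finally have "s \<le> log_norm (q * N) \<omega> \<theta>" using \<omega>(2) by (simp add: s_def)
      then show "\<omega> \<in> {\<omega> \<in> space B. exp (t * log_norm (q * N) \<omega> \<theta>) \<ge> exp (t * s)}"
        using \<omega>(1) assms(2) by simp
    qed
  qed measurable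
  also have "\<dots> \<le> (\<integral>\<omega>. exp (t * log_norm (q * N) \<omega> \<theta>) \<partial>B) / exp (t * s)"
    using integrable_exp_log_norm[of t] assms(2) by (intro integral_Markov_inequality_measure[where A = "{}"]) auto
  also have "\<dots> \<le> a ^ q / exp (t * s)"
    using exp_moment_power[OF less_imp_le[OF assms(2)] exp_moment_le[OF less_imp_le[OF assms(2)] assms(3,4) b]]
    by (intro divide_right_mono) (auto simp: a_def)
  also have "\<dots> = exp (real q * (t * (real N * b) + (t * (real N * c))\<^sup>2) - t * s)"
    by (simp add: a_def exp_diff flip: exp_of_nat_mult)
  also have "\<dots> \<le> exp (t * (real N * c) - t * (real n * \<eta>) / 2)"
  proof -
    have qN: "real q * real N \<le> real n" using n(1) by simp
    have "real q * (t * (real N * b)) = t * b * (real q * real N)" by simp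
    also have "\<dots> \<le> t * b * real n" using qN assms(2) \<open>0 \<le> b\<close> by (intro mult_left_mono) auto
    finally have 1: "real q * (t * (real N * b)) \<le> t * b * real n" .
    have "real q * (t * (real N * c))\<^sup>2 = t * (t * (real N * c\<^sup>2)) * (real q * real N)"
      by (simp add: power2_eq_square)
    also have "\<dots> \<le> t * (\<eta> / 2) * real n"
      using \<eta>  qN assms(2,5) c by (intro mult_mono mult_left_mono) auto
    finally have 2: "real q * (t * (real N * c))\<^sup>2 \<le> t * (\<eta> / 2) * real n" .
    from 1 2 show ?thesis by (simp add: s_def algebra_simps)
  qed
  finally show ?thesis .
qed

end

section \<open>Large deviations and upper semicontinuity of the exponent\<close>

text \<open>The estimate from which both parts of the theorem are derived.  Its block length \<open>N\<close> is the
same for all nearby laws and all starting points.\<close>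

lemma uniform_block_estimate:
  fixes \<nu>0 :: "('d::finite, 'm::finite) cocycle measure"
  assumes "\<nu>0 \<in> ergodic_measures L" "0 < \<epsilon>"
  obtains \<delta> N where "0 < \<delta>" "1 \<le> N"
    "\<And>\<nu> \<theta>. \<lbrakk>\<nu> \<in> Prob_c (cocycles_le L); W1 (cocycles_le L) \<nu> \<nu>0 < \<delta>\<rbrakk>
      \<Longrightarrow> (\<integral>\<omega>. log_norm N \<omega> \<theta> \<partial>bernoulli_measure \<nu>) \<le> real N * (L1 \<nu>0 + \<epsilon>)"
proof -
  have law0: "\<nu>0 \<in> Prob_c (cocycles_le L)" using assms(1) by (simp add: ergodic_measures_def)
  interpret \<nu>0: ergodic_law \<nu>0 L
    using assms(1) by unfold_locales (auto simp: ergodic_measures_def)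
  obtain N where N: "1 \<le> N" "\<And>\<theta>. (\<integral>\<omega>. log_norm N \<omega> \<theta> \<partial>\<nu>0.B) \<le> real N * (L1 \<nu>0 + \<epsilon> / 2)"
    using \<nu>0.uniform_expected_growth[of "\<epsilon> / 2"] assms(2) unfolding \<nu>0.L1_eq_growth by auto
  have "0 < real N * \<epsilon> / 2" using N(1) assms(2) by simp
  from expected_log_norm_upper_semicontinuous[OF law0 this, of N] obtain \<delta> where \<delta>: "0 < \<delta>"
    "\<forall>\<nu>\<in>Prob_c (cocycles_le L). W1 (cocycles_le L) \<nu> \<nu>0 < \<delta> \<longrightarrow>
    (\<forall>\<theta>. (\<integral>\<omega>. log_norm N \<omega> \<theta> \<partial>bernoulli_measure \<nu>) \<le> (\<integral>\<omega>. log_norm N \<omega> \<theta> \<partial>\<nu>0.B) + real N * \<epsilon> / 2)"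
    by blast
  show thesis
  proof (rule that[OF \<delta>(1) N(1)])
    fix \<nu> :: "('d, 'm) cocycle measure" and \<theta> :: "'d torus"
    assume "\<nu> \<in> Prob_c (cocycles_le L)" "W1 (cocycles_le L) \<nu> \<nu>0 < \<delta>"
    then have "(\<integral>\<omega>. log_norm N \<omega> \<theta> \<partial>bernoulli_measure \<nu>) \<le> (\<integral>\<omega>. log_norm N \<omega> \<theta> \<partial>\<nu>0.B) + real N * \<epsilon> / 2"
      using \<delta>(2) by blast
    with N(2)[of \<theta>] show "(\<integral>\<omega>. log_norm N \<omega> \<theta> \<partial>bernoulli_measure \<nu>) \<le> real N * (L1 \<nu>0 + \<epsilon>)"
      by (simp add: algebra_simps)
  qed
qed

theorem theorem3p1:
  fixes L :: real
  shows "(\<forall>\<nu>\<^sub>0 \<in> (ergodic_measures L :: ('d::finite, 'm::finite) cocycle measure set). \<forall>\<epsilon>>0.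
           \<exists>\<delta>>0. \<exists>n\<^sub>0 :: nat. \<exists>c>0.
             \<forall>\<nu> \<in> Prob_c (cocycles_le L). W1 (cocycles_le L) \<nu> \<nu>\<^sub>0 < \<delta> \<longrightarrow>
               (\<forall>\<theta>. \<forall>n\<ge>n\<^sub>0.
                  measure (bernoulli_measure \<nu>)
                    {\<omega> \<in> space (bernoulli_measure \<nu>).
                       1 / real n * ln (norm (iterate n \<omega> \<theta>)) \<ge> L1 \<nu>\<^sub>0 + \<epsilon>}
                  < exp (- c * real n)))
         \<and> upper_semicontinuous_wrt (W1 (cocycles_le L))
             (ergodic_measures L :: ('d, 'm) cocycle measure set) L1"
proof (intro conjI ballI allI impI)
  fix \<nu>\<^sub>0 :: "('d, 'm) cocycle measure" and \<epsilon> :: real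
  assume \<nu>0: "\<nu>\<^sub>0 \<in> ergodic_measures L" and "0 < \<epsilon>"
  interpret \<nu>0: cocycle_law \<nu>\<^sub>0 L using \<nu>0 by unfold_locales (simp add: ergodic_measures_def)
  obtain \<delta> N where \<delta>: "0 < \<delta>" and N: "1 \<le> N" and block: "\<And>\<nu> \<theta>. \<lbrakk>\<nu> \<in> Prob_c (cocycles_le L); W1 (cocycles_le L) \<nu> \<nu>\<^sub>0 < \<delta>\<rbrakk>
      \<Longrightarrow> (\<integral>\<omega>. log_norm N \<omega> \<theta> \<partial>bernoulli_measure \<nu>) \<le> real N * (L1 \<nu>\<^sub>0 + \<epsilon> / 2)"
    using uniform_block_estimate[OF \<nu>0, of "\<epsilon> / 2"] \<open>0 < \<epsilon>\<close> by (metis half_gt_zero)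
  \<comment> \<open>The summand 1 keeps the constant positive when \<open>L = 1\<close>.\<close>
  define C where "C = ln L + 1"
  have C: "0 < C" "ln L \<le> C" using \<nu>0.L_ge_1 by (simp_all add: C_def add_nonneg_pos)
  define t where "t = min (1 / (real N * C)) (\<epsilon> / 4 / (real N * C\<^sup>2))"
  have t: "0 < t" using N C \<open>0 < \<epsilon>\<close> by (simp add: t_def)
  have "0 < real N * C" "0 < real N * C\<^sup>2" using N C by simp_all
  moreover have "t \<le> 1 / (real N * C)" "t \<le> \<epsilon> / 4 / (real N * C\<^sup>2)" by (simp_all add: t_def)
  ultimately have t1: "t * (real N * C) \<le> 1" and t2: "t * (real N * C\<^sup>2) \<le> (\<epsilon> / 2) / 2"
    using pos_le_divide_eq[of "real N * C" t 1] pos_le_divide_eq[of "real N * C\<^sup>2" t "\<epsilon> / 4"] by simp_all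
  \<comment> \<open>From \<open>n\<^sub>0\<close> on, the constant \<open>t N C\<close> is less than half of the remaining gain \<open>t n \<epsilon> / 4\<close>.\<close>
  define n\<^sub>0 where "n\<^sub>0 = Suc (nat \<lceil>8 * real N * C / \<epsilon>\<rceil>)"
  define c where "c = t * \<epsilon> / 8"
  show "\<exists>\<delta>>0. \<exists>n\<^sub>0 :: nat. \<exists>c>0. \<forall>\<nu> \<in> Prob_c (cocycles_le L). W1 (cocycles_le L) \<nu> \<nu>\<^sub>0 < \<delta> \<longrightarrow>
               (\<forall>\<theta>. \<forall>n\<ge>n\<^sub>0. measure (bernoulli_measure \<nu>) {\<omega> \<in> space (bernoulli_measure \<nu>).
                       1 / real n * ln (norm (iterate n \<omega> \<theta>)) \<ge> L1 \<nu>\<^sub>0 + \<epsilon>} < exp (- c * real n))"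
  proof (rule exI[of _ \<delta>], rule conjI[OF \<delta>], rule exI[of _ n\<^sub>0], rule exI[of _ c],
      intro conjI ballI impI allI)
    show "0 < c" using t \<open>0 < \<epsilon>\<close> by (simp add: c_def)
    fix \<nu> :: "('d, 'm) cocycle measure" and \<theta> :: "'d torus" and n
    assume \<nu>: "\<nu> \<in> Prob_c (cocycles_le L)" "W1 (cocycles_le L) \<nu> \<nu>\<^sub>0 < \<delta>" and n: "n\<^sub>0 \<le> n"
    interpret \<nu>: cocycle_law \<nu> L by unfold_locales fact
    have "0 < n" using n by (simp add: n\<^sub>0_def)
    have "8 * real N * C / \<epsilon> < real n" using n unfolding n\<^sub>0_def by linarith
    then have big: "8 * (real N * C) < real n * \<epsilon>" using \<open>0 < \<epsilon>\<close> by (simp add: field_simps)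
    have "{\<omega> \<in> space \<nu>.B. 1 / real n * ln (norm (iterate n \<omega> \<theta>)) \<ge> L1 \<nu>\<^sub>0 + \<epsilon>}
        = {\<omega> \<in> space \<nu>.B. log_norm n \<omega> \<theta> \<ge> real n * ((L1 \<nu>\<^sub>0 + \<epsilon> / 2) + \<epsilon> / 2)}"
      using \<open>0 < n\<close> by (auto simp: log_norm_def field_simps)
    then have "measure \<nu>.B {\<omega> \<in> space \<nu>.B. 1 / real n * ln (norm (iterate n \<omega> \<theta>)) \<ge> L1 \<nu>\<^sub>0 + \<epsilon>}
        \<le> exp (t * (real N * C) - t * (real n * (\<epsilon> / 2)) / 2)"
      using \<nu>.large_deviation_bound[OF N t t1 C(2) t2 block[OF \<nu>]] by simp
    also have "\<dots> < exp (- c * real n)"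
      using mult_strict_left_mono[OF big t] by (simp add: c_def algebra_simps)
    finally show "measure \<nu>.B {\<omega> \<in> space \<nu>.B. 1 / real n * ln (norm (iterate n \<omega> \<theta>)) \<ge> L1 \<nu>\<^sub>0 + \<epsilon>} < exp (- c * real n)" .
  qed
next
  show "upper_semicontinuous_wrt (W1 (cocycles_le L)) (ergodic_measures L :: ('d, 'm) cocycle measure set) L1"
    unfolding upper_semicontinuous_wrt_def
  proof (intro ballI allI impI)
    fix \<nu>\<^sub>0 :: "('d, 'm) cocycle measure" and \<epsilon> :: real
    assume \<nu>0: "\<nu>\<^sub>0 \<in> ergodic_measures L" and "0 < \<epsilon>"
    obtain \<delta> N where \<delta>: "0 < \<delta>" and N: "1 \<le> N" and block: "\<And>\<nu> \<theta>. \<lbrakk>\<nu> \<in> Prob_c (cocycles_le L); W1 (cocycles_le L) \<nu> \<nu>\<^sub>0 < \<delta>\<rbrakk>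
        \<Longrightarrow> (\<integral>\<omega>. log_norm N \<omega> \<theta> \<partial>bernoulli_measure \<nu>) \<le> real N * (L1 \<nu>\<^sub>0 + \<epsilon> / 2)"
      using uniform_block_estimate[OF \<nu>0, of "\<epsilon> / 2"] \<open>0 < \<epsilon>\<close> by (metis half_gt_zero)
    have "L1 \<nu> < L1 \<nu>\<^sub>0 + \<epsilon>" if \<nu>: "\<nu> \<in> ergodic_measures L" "W1 (cocycles_le L) \<nu> \<nu>\<^sub>0 < \<delta>" for \<nu>
    proof -
      interpret \<nu>: ergodic_law \<nu> L using \<nu>(1) by unfold_locales (auto simp: ergodic_measures_def)
      have "L1 \<nu> \<le> L1 \<nu>\<^sub>0 + \<epsilon> / 2"
        unfolding \<nu>.L1_eq_growth using N block[OF \<nu>.law \<nu>(2)] by (rule \<nu>.growth_le_if_uniform)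
      then show ?thesis using \<open>0 < \<epsilon>\<close> by simp
    qed
    with \<delta> show "\<exists>\<delta>>0. \<forall>\<nu>\<in>ergodic_measures L. W1 (cocycles_le L) \<nu> \<nu>\<^sub>0 < \<delta> \<longrightarrow> L1 \<nu> < L1 \<nu>\<^sub>0 + \<epsilon>" by blast
  qed
qed

end
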